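(* Let $f$ be a smooth function on an open subset $U$ of $\mathbb{R}^3$, homogeneous of degree $d>2$, such that the Hessian determinant $H(f)=\det(\partial^2 f/\partial x_i\partial x_j)$ is nonzero on $U$. Consider the pseudo-Riemannian metric $-\frac{1}{d(d-1)}\partial^2 f/\partial x_i\partial x_j$ on $U$, and let $M=\{x\in U: f(x)=1\}$ with the restricted metric. Then at any point of $M$, the sectional curvature of $U$ on the tangent 2-plane to $M$ is $$K=\frac{d^2(d-1)^2}{4(d-2)^2}\,\frac{S(f)\,f}{H(f)^2},$$ and the sectional curvature of the surface $M$ at that point is $$K_M=-\frac{d^2}{4}+\frac{d^2(d-1)^2}{4(d-2)^2}\,\frac{S(f)\,f^2}{H(f)^2}.$$
   Context: Write $f_{ijk}=\partial^3 f/\partial x_i\partial x_j\partial x_k$ and set $a_3=f_{333}$, $a_2=f_{133}$, $b_2=f_{233}$, $a_1=f_{113}$, $b_1=f_{123}$, $c_1=f_{223}$, $a_0=f_{111}$, $b_0=f_{112}$, $c_0=f_{122}$, $d_0=f_{222}$. The Clebsch covariant $S(f)$ is $S(f)=-(a_0a_2-a_1^2)c_1^2+(a_0a_3-a_1a_2)c_0c_1-(a_1a_3-a_2^2)c_0^2-b_0^2a_3c_1+b_0b_1(3a_2c_1+a_3c_0)-(b_0b_2+2b_1^2)(a_1c_1+a_2c_0)+b_1b_2(a_0c_1+3a_1c_0)-b_2^2a_0c_0+d_0[b_0(a_1a_3-a_2^2)-b_1(a_0a_3-a_1a_2)+b_2(a_0a_2-a_1^2)]+(b_0b_2-b_1^2)^2.$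 Sectional curvature of a 2-plane spanned by $v,w$ uses the standard formula $R(v,w,v,w)/(\langle v,v\rangle\langle w,w\rangle-\langle v,w\rangle^2)$ for the Levi-Civita connection of the pseudo-Riemannian metric. *)

theory Defs
  imports "HOL-Analysis.Analysis"
begin

definition pd :: "'n::finite \<Rightarrow> (real^'n \<Rightarrow> real) \<Rightarrow> real^'n \<Rightarrow> real" where
  "pd i g x = deriv (\<lambda>t. g (x + t *\<^sub>R axis i 1)) 0"

fun iter_pd :: "'n::finite list \<Rightarrow> (real^'n \<Rightarrow> real) \<Rightarrow> real^'n \<Rightarrow> real" where
  "iter_pd [] g = g"
| "iter_pd (i # is) g = pd i (iter_pd is g)"

definition smooth_on :: "(real^'n::finite \<Rightarrow> real) \<Rightarrow> (real^'n) set \<Rightarrow> bool" where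
  "smooth_on g U \<longleftrightarrow> (\<forall>is. iter_pd is g differentiable_on U)"

definition hessian :: "(real^'n::finite \<Rightarrow> real) \<Rightarrow> real^'n \<Rightarrow> real^'n^'n" where
  "hessian f x = (\<chi> i j. pd i (pd j f) x)"

definition hessdet :: "(real^'n::finite \<Rightarrow> real) \<Rightarrow> real^'n \<Rightarrow> real" where
  "hessdet f x = det (hessian f x)"

definition gradient :: "(real^'n::finite \<Rightarrow> real) \<Rightarrow> real^'n \<Rightarrow> real^'n" where
  "gradient f x = (\<chi> i. pd i f x)"

definition f3 :: "(real^3 \<Rightarrow> real) \<Rightarrow> 3 \<Rightarrow> 3 \<Rightarrow> 3 \<Rightarrow> real^3 \<Rightarrow> real" where
  "f3 f i j k x = pd i (pd j (pd k f)) x"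

definition clebsch_S :: "(real^3 \<Rightarrow> real) \<Rightarrow> real^3 \<Rightarrow> real" where
  "clebsch_S f x =
    (let a3 = f3 f 3 3 3 x; a2 = f3 f 1 3 3 x; b2 = f3 f 2 3 3 x;
         a1 = f3 f 1 1 3 x; b1 = f3 f 1 2 3 x; c1 = f3 f 2 2 3 x;
         a0 = f3 f 1 1 1 x; b0 = f3 f 1 1 2 x; c0 = f3 f 1 2 2 x; d0 = f3 f 2 2 2 x
     in - (a0*a2 - a1^2)*c1^2 + (a0*a3 - a1*a2)*c0*c1 - (a1*a3 - a2^2)*c0^2
        - b0^2*a3*c1 + b0*b1*(3*a2*c1 + a3*c0)
        - (b0*b2 + 2*b1^2)*(a1*c1 + a2*c0)
        + b1*b2*(a0*c1 + 3*a1*c0) - b2^2*a0*c0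
        + d0*(b0*(a1*a3 - a2^2) - b1*(a0*a3 - a1*a2) + b2*(a0*a2 - a1^2))
        + (b0*b2 - b1^2)^2)"

definition christoffel :: "(real^'n::finite \<Rightarrow> real^'n^'n) \<Rightarrow> 'n \<Rightarrow> 'n \<Rightarrow> 'n \<Rightarrow> real^'n \<Rightarrow> real" where
  "christoffel G k i j x = (1/2) * (\<Sum>l\<in>UNIV. matrix_inv (G x) $ k $ l *
      (pd i (\<lambda>y. G y $ j $ l) x + pd j (\<lambda>y. G y $ i $ l) x - pd l (\<lambda>y. G y $ i $ j) x))"

text \<open>Curvature tensor components R^l_ijk with
  R(d_i,d_j) d_k = nabla_i nabla_j d_k - nabla_j nabla_i d_k = sum_l R^l_ijk d_l.\<close>
definition riemann :: "(real^'n::finite \<Rightarrow> real^'n^'n) \<Rightarrow> 'n \<Rightarrow> 'n \<Rightarrow> 'n \<Rightarrow> 'n \<Rightarrow> real^'n \<Rightarrow> real" where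
  "riemann G l i j k x =
     pd i (christoffel G l j k) x - pd j (christoffel G l i k) x
     + (\<Sum>m\<in>UNIV. christoffel G l i m x * christoffel G m j k x
                  - christoffel G l j m x * christoffel G m i k x)"

definition metric_ip :: "(real^'n::finite \<Rightarrow> real^'n^'n) \<Rightarrow> real^'n \<Rightarrow> real^'n \<Rightarrow> real^'n \<Rightarrow> real" where
  "metric_ip G x v w = (\<Sum>i\<in>UNIV. \<Sum>j\<in>UNIV. G x $ i $ j * v $ i * w $ j)"

definition riem4 :: "(real^'n::finite \<Rightarrow> real^'n^'n) \<Rightarrow> real^'n \<Rightarrow> real^'n \<Rightarrow> real^'n \<Rightarrow> real^'n \<Rightarrow> real^'n \<Rightarrow> real" where
  "riem4 G x v w z u = (\<Sum>i\<in>UNIV. \<Sum>j\<in>UNIV. \<Sum>k\<in>UNIV. \<Sum>l\<in>UNIV. \<Sum>m\<in>UNIV.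
      riemann G l i j k x * v $ i * w $ j * z $ k * G x $ l $ m * u $ m)"

text \<open>Sectional curvature of the plane spanned by v, w (sign convention: the unit
  sphere has curvature +1).\<close>
definition sectional_curvature :: "(real^'n::finite \<Rightarrow> real^'n^'n) \<Rightarrow> real^'n \<Rightarrow> real^'n \<Rightarrow> real^'n \<Rightarrow> real" where
  "sectional_curvature G x v w =
     riem4 G x v w w v / (metric_ip G x v v * metric_ip G x w w - (metric_ip G x v w)^2)"

definition hess_metric :: "real \<Rightarrow> (real^3 \<Rightarrow> real) \<Rightarrow> real^3 \<Rightarrow> real^3^3" where
  "hess_metric d f x = (- 1 / (d * (d - 1))) *\<^sub>R hessian f x"

definition jac_col :: "(real^2 \<Rightarrow> real^3) \<Rightarrow> 2 \<Rightarrow> real^2 \<Rightarrow> real^3" where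
  "jac_col \<phi> a y = (\<chi> i. pd a (\<lambda>z. \<phi> z $ i) y)"

definition pullback_metric :: "(real^3 \<Rightarrow> real^3^3) \<Rightarrow> (real^2 \<Rightarrow> real^3) \<Rightarrow> real^2 \<Rightarrow> real^2^2" where
  "pullback_metric G \<phi> y = (\<chi> a b. metric_ip G (\<phi> y) (jac_col \<phi> a y) (jac_col \<phi> b y))"

definition local_param :: "(real^2 \<Rightarrow> real^3) \<Rightarrow> (real^2) set \<Rightarrow> (real^3) set \<Rightarrow> bool" where
  "local_param \<phi> V M \<longleftrightarrow> open V \<and> \<phi> ` V \<subseteq> M \<and> (\<forall>i. smooth_on (\<lambda>y. \<phi> y $ i) V)
     \<and> (\<forall>y\<in>V. inj_on \<phi> V \<and> independent {jac_col \<phi> 1 y, jac_col \<phi> 2 y}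
               \<and> jac_col \<phi> 1 y \<noteq> jac_col \<phi> 2 y)"

end

(* Everything is expressed through the metric g = -Hess f / (d (d - 1)) and its first derivatives,
   which form a totally symmetric cubic form C proportional to f_ijk. For such a metric the second
   derivatives of g cancel in the curvature tensor, which becomes -1/4 of the alternation of the
   inverse metric contracted with two copies of C. Euler's identities say that the position vector
   p is g-orthogonal to the tangent plane of M and that C contracted with p is (d - 2) g. In a frame
   p, v, w with v, w tangent to M two coefficients of C vanish, so S(C) collapses to the curvature
   expression, and the SL_3-covariance of S transports this back to the standard coordinates.
   For M itself the Gauss equation is verified in coordinates: the normal direction is p, where
   g(p,p) = -f = -1 and the second fundamental form is -d/2 times the induced metric; this
   accounts for the term -d^2/4. *)

theory Submission
  imports Defs
begin

section \<open>Calculus of iterated partial derivatives\<close>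

text \<open>Curvature differentiates the inverse metric. This is avoided by lowering the upper index
  throughout: applying the product rule to "metric times Christoffel symbol = symbol of the first
  kind" trades the derivative of the inverse for first derivatives of the metric, and the inverse
  itself only has to be differentiable. Smoothness is given through iterated partial derivatives, so
  closure properties and symmetry of mixed partials are derived from that form. Constants: 1/4 is
  one half from each of the two Christoffel symbols in a quadratic term, and (d - 2)^2 is the square
  of the Euler factor of C. As S has degree 4 in C and a 3 by 3 determinant has degree 3, the factor
  -1/(d (d - 1)) enters with power 4 against power 6; its inverse square is d^2 (d - 1)^2. The
  coefficient -d/2 is the sum of -(d - 1), from differentiating the orthogonality of p to M, and (d
  - 2)/2, from C contracted with p.\<close>

lemma pd_eq:
  assumes "(g has_derivative g') (at x)"
  shows "pd i g x = g' (axis i 1)"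
proof -
  have "((\<lambda>t. g (x + t *\<^sub>R axis i 1)) has_derivative (\<lambda>t. g' (t *\<^sub>R axis i 1))) (at 0)"
    by (rule has_derivative_compose[of "\<lambda>t. x + t *\<^sub>R axis i 1", where g = g])
       (auto intro!: derivative_eq_intros assms)
  moreover have "(\<lambda>t. g' (t *\<^sub>R axis i 1)) = (*) (g' (axis i 1))"
    using has_derivative_linear[OF assms] by (auto simp: linear_scale)
  ultimately show ?thesis
    unfolding pd_def by (intro DERIV_imp_deriv) (simp add: has_field_derivative_def)
qed

lemma frechet_pd:
  assumes "g differentiable (at x)"
  shows "(g has_derivative (\<lambda>h. \<Sum>i\<in>UNIV. pd i g x * h$i)) (at x)"
proof -
  obtain g' where g': "(g has_derivative g') (at x)"
    using assms unfolding differentiable_def by blast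
  have "g' h = (\<Sum>i\<in>UNIV. pd i g x * h$i)" for h
  proof -
    have "g' h = g' (\<Sum>i\<in>UNIV. h$i *\<^sub>R axis i 1)"
      by (simp add: basis_expansion flip: scalar_mult_eq_scaleR)
    also have "\<dots> = (\<Sum>i\<in>UNIV. pd i g x * h$i)"
      using has_derivative_linear[OF g']
      by (simp add: linear_sum linear_scale pd_eq[OF g'] o_def mult.commute)
    finally show ?thesis .
  qed
  then have "g' = (\<lambda>h. \<Sum>i\<in>UNIV. pd i g x * h$i)" by blast
  with g' show ?thesis by simp
qed

lemma pd_cong:
  assumes "open U" "x \<in> U" "\<And>y. y \<in> U \<Longrightarrow> f y = g y"
  shows "pd i f x = pd i g x"
  unfolding pd_def
proof (rule deriv_cong_ev)
  have "((\<lambda>t::real. x + t *\<^sub>R axis i 1) \<longlongrightarrow> x + 0 *\<^sub>R axis i 1) (nhds 0)"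
    by (intro tendsto_intros filterlim_ident)
  then have "\<forall>\<^sub>F t in nhds 0. x + t *\<^sub>R axis i 1 \<in> U"
    using assms(1,2) by (simp add: tendsto_def)
  then show "\<forall>\<^sub>F t in nhds 0. f (x + t *\<^sub>R axis i 1) = g (x + t *\<^sub>R axis i 1)"
    by eventually_elim (rule assms(3))
qed simp

lemma pd_const [simp]: "pd i (\<lambda>x. c) x = 0"
  by (simp add: pd_def)

lemma pd_coord: "pd j (\<lambda>x. x $ i) x = (if i = j then 1 else 0)"
  by (subst pd_eq[where g'="\<lambda>h. h $ i"]) (auto simp: axis_def intro!: derivative_eq_intros bounded_linear.has_derivative[OF bounded_linear_vec_nth])

lemma pd_add:
  assumes "f differentiable (at x)" "g differentiable (at x)"
  shows "pd i (\<lambda>y. f y + g y) x = pd i f x + pd i g x"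
proof -
  obtain f' g' where "(f has_derivative f') (at x)" "(g has_derivative g') (at x)"
    using assms unfolding differentiable_def by blast
  then show ?thesis
    by (simp add: pd_eq has_derivative_add[THEN pd_eq])
qed

lemma pd_mult:
  assumes "f differentiable (at x)" "g differentiable (at x)"
  shows "pd i (\<lambda>y. f y * g y) x = pd i f x * g x + f x * pd i g x"
proof -
  obtain f' g' where "(f has_derivative f') (at x)" "(g has_derivative g') (at x)"
    using assms unfolding differentiable_def by blast
  then show ?thesis
    by (simp add: pd_eq has_derivative_mult[THEN pd_eq])
qed

lemma pd_cmult:
  assumes "g differentiable (at x)"
  shows "pd i (\<lambda>y. c * g y) x = c * pd i g x"
  by (simp add: pd_mult assms)

lemma pd_sum:
  assumes "\<And>a. a \<in> A \<Longrightarrow> f a differentiable (at x)"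
  shows "pd i (\<lambda>y. \<Sum>a\<in>A. f a y) x = (\<Sum>a\<in>A. pd i (f a) x)"
  using assms
proof (induction A rule: infinite_finite_induct)
  case (insert a A)
  then have "(\<lambda>y. \<Sum>a\<in>A. f a y) differentiable (at x)"
    by (auto intro: differentiable_sum)
  with insert show ?case by (simp add: pd_add)
qed simp_all

lemma differentiable_coordinates:
  fixes \<phi> :: "'a::real_normed_vector \<Rightarrow> real^'n"
  assumes "\<And>i. (\<lambda>y. \<phi> y $ i) differentiable (at y)"
  shows "\<phi> differentiable (at y)"
proof -
  obtain D where D: "\<And>i. ((\<lambda>y. \<phi> y $ i) has_derivative D i) (at y)"
    using assms unfolding differentiable_def by metis
  have "(\<phi> has_derivative (\<lambda>h. \<chi> i. D i h)) (at y)"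
    by (subst has_derivative_componentwise_within)
       (auto simp: Basis_vec_def inner_axis D)
  then show ?thesis unfolding differentiable_def by blast
qed

lemma pd_compose:
  fixes \<phi> :: "real^'m \<Rightarrow> real^'n"
  assumes g: "g differentiable (at (\<phi> y))" and \<phi>: "\<And>i. (\<lambda>y. \<phi> y $ i) differentiable (at y)"
  shows "pd a (\<lambda>y. g (\<phi> y)) y = (\<Sum>i\<in>UNIV. pd i g (\<phi> y) * pd a (\<lambda>y. \<phi> y $ i) y)"
proof -
  obtain \<phi>' where \<phi>': "(\<phi> has_derivative \<phi>') (at y)"
    using differentiable_coordinates[OF \<phi>] unfolding differentiable_def by blast
  have "pd a (\<lambda>y. \<phi> y $ i) y = \<phi>' (axis a 1) $ i" for i
    by (rule pd_eq[OF bounded_linear.has_derivative[OF bounded_linear_vec_nth \<phi>']])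
  moreover have "pd a (\<lambda>y. g (\<phi> y)) y = (\<Sum>i\<in>UNIV. pd i g (\<phi> y) * \<phi>' (axis a 1) $ i)"
    by (rule pd_eq[OF has_derivative_compose[OF \<phi>' frechet_pd[OF g]]])
  ultimately show ?thesis by simp
qed

section \<open>Smoothness of finite order and its closure properties\<close>

primrec k_smooth_on :: "nat \<Rightarrow> (real^'n::finite \<Rightarrow> real) \<Rightarrow> (real^'n) set \<Rightarrow> bool" where
  "k_smooth_on 0 g U \<longleftrightarrow> g differentiable_on U"
| "k_smooth_on (Suc k) g U \<longleftrightarrow> g differentiable_on U \<and> (\<forall>i. k_smooth_on k (pd i g) U)"

lemma k_smooth_on_differentiable: "k_smooth_on k g U \<Longrightarrow> g differentiable_on U"
  by (cases k) auto

lemma iter_pd_append: "iter_pd (is @ js) g = iter_pd is (iter_pd js g)"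
  by (induction "is") auto

lemma smooth_on_pd: "smooth_on g U \<Longrightarrow> smooth_on (pd i g) U"
  unfolding smooth_on_def by (metis iter_pd.simps iter_pd_append)

lemma smooth_on_differentiable_on: "smooth_on g U \<Longrightarrow> g differentiable_on U"
  unfolding smooth_on_def by (metis iter_pd.simps(1))

lemma smooth_on_differentiable:
  "smooth_on g U \<Longrightarrow> open U \<Longrightarrow> x \<in> U \<Longrightarrow> g differentiable (at x)"
  by (meson differentiable_on_eq_differentiable_at smooth_on_differentiable_on)

text \<open>Derivatives of products and composites are sums of products of other functions, so
  closure is an induction on the order for all functions at once. The graded notion supports this
  induction; the equivalence carries the results back.\<close>

lemma smooth_on_iff_k_smooth_on: "smooth_on g U \<longleftrightarrow> (\<forall>k. k_smooth_on k g U)"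
proof
  assume "smooth_on g U"
  then have "k_smooth_on k g U" for k
    by (induction k arbitrary: g) (auto intro: smooth_on_pd smooth_on_differentiable_on)
  then show "\<forall>k. k_smooth_on k g U" ..
next
  assume k: "\<forall>k. k_smooth_on k g U"
  have "iter_pd is g differentiable_on U" if "\<forall>k. k_smooth_on k g U" for "is" g
    using that
  \<comment> \<open>Reverse induction, because \<open>k_smooth_on\<close> peels off the derivative
    that is applied first, and this is the last entry of the list.\<close>
  proof (induction "is" arbitrary: g rule: rev_induct)
    case Nil
    then show ?case by (metis iter_pd.simps(1) k_smooth_on.simps(1))
  next
    case (snoc i "is")
    then have "\<forall>k. k_smooth_on k (pd i g) U"
      by (meson k_smooth_on.simps(2))
    with snoc.IH show ?case by (simp add: iter_pd_append)
  qed
  with k show "smooth_on g U" by (simp add: smooth_on_def)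
qed

lemma k_smooth_on_Suc_imp: "k_smooth_on (Suc k) g U \<Longrightarrow> k_smooth_on k g U"
  by (induction k arbitrary: g) auto

lemma differentiable_on_cong_eq:
  assumes "\<And>y. y \<in> U \<Longrightarrow> f y = g y" "f differentiable_on U"
  shows "g differentiable_on U"
  unfolding differentiable_on_def
proof
  fix x assume "x \<in> U"
  with assms show "g differentiable (at x within U)"
    by (intro differentiable_transform_within[of f x U 1 g]) (auto simp: differentiable_on_def)
qed

lemma k_smooth_on_cong:
  assumes "open U" "\<And>y. y \<in> U \<Longrightarrow> f y = g y" "k_smooth_on k f U"
  shows "k_smooth_on k g U"
  using assms(2,3)
proof (induction k arbitrary: f g)
  case 0
  then show ?case
    unfolding k_smooth_on.simps by (blast intro: differentiable_on_cong_eq)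
next
  case (Suc k)
  have "k_smooth_on k (pd i g) U" for i
  proof (rule Suc.IH[of "pd i f"])
    show "pd i f y = pd i g y" if "y \<in> U" for y
      by (rule pd_cong[OF assms(1) that Suc.prems(1)])
    show "k_smooth_on k (pd i f) U"
      using Suc.prems(2) by simp
  qed
  with Suc.prems show ?case
    using differentiable_on_cong_eq[of U f g] by auto
qed

lemma k_smooth_on_const: "k_smooth_on k (\<lambda>x. c) U"
  for U :: "(real^'n) set"
proof (induction k arbitrary: c)
  case (Suc k)
  have "pd i (\<lambda>x. c) = (\<lambda>x. 0)" for i :: 'n by (rule ext) simp
  with Suc show ?case by simp
qed simp

lemma k_smooth_on_add:
  assumes "open U" "k_smooth_on k f U" "k_smooth_on k g U"
  shows "k_smooth_on k (\<lambda>x. f x + g x) U"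
  using assms(2,3)
proof (induction k arbitrary: f g)
  case (Suc k)
  have "k_smooth_on k (pd i (\<lambda>x. f x + g x)) U" for i
  proof (rule k_smooth_on_cong[OF assms(1)])
    show "k_smooth_on k (\<lambda>x. pd i f x + pd i g x) U"
      using Suc by simp
    show "pd i f y + pd i g y = pd i (\<lambda>x. f x + g x) y" if "y \<in> U" for y
      using Suc.prems that assms(1)
      by (subst pd_add) (auto simp: differentiable_on_eq_differentiable_at)
  qed
  with Suc.prems show ?case by simp
qed simp

lemma k_smooth_on_mult:
  assumes "open U" "k_smooth_on k f U" "k_smooth_on k g U"
  shows "k_smooth_on k (\<lambda>x. f x * g x) U"
  using assms(2,3)
proof (induction k arbitrary: f g)
  case (Suc k)
  have "k_smooth_on k (pd i (\<lambda>x. f x * g x)) U" for i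
  proof (rule k_smooth_on_cong[OF assms(1)])
    \<comment> \<open>The undifferentiated factors are lowered from order \<open>Suc k\<close> to
      \<open>k\<close>, so that the induction hypothesis covers both products.\<close>
    show "k_smooth_on k (\<lambda>x. pd i f x * g x + f x * pd i g x) U"
      using Suc k_smooth_on_Suc_imp[OF Suc.prems(1)] k_smooth_on_Suc_imp[OF Suc.prems(2)]
      by (intro k_smooth_on_add assms(1) Suc.IH) simp_all
    show "pd i f y * g y + f y * pd i g y = pd i (\<lambda>x. f x * g x) y" if "y \<in> U" for y
      using Suc.prems that assms(1)
      by (subst pd_mult) (auto simp: differentiable_on_eq_differentiable_at)
  qed
  with Suc.prems show ?case by simp
qed simp

lemma k_smooth_on_sum:
  assumes "open U" "\<And>a. a \<in> A \<Longrightarrow> k_smooth_on k (f a) U"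
  shows "k_smooth_on k (\<lambda>x. \<Sum>a\<in>A. f a x) U"
  using assms(2)
  by (induction A rule: infinite_finite_induct) (auto intro: k_smooth_on_const k_smooth_on_add assms(1))

text \<open>By the chain rule, derivatives of the composite are built from \<open>pd i g\<close>
  composed with \<open>\<phi>\<close> and partials of \<open>\<phi>\<close>; the induction therefore
  varies \<open>g\<close> and keeps \<open>\<phi>\<close> fixed.\<close>

lemma k_smooth_on_compose:
  fixes \<phi> :: "real^'m \<Rightarrow> real^'n"
  assumes "open U" "open V" "\<phi> ` V \<subseteq> U" "k_smooth_on k g U" "\<And>i. k_smooth_on k (\<lambda>y. \<phi> y $ i) V"
  shows "k_smooth_on k (\<lambda>y. g (\<phi> y)) V"
  using assms(4,5)
proof (induction k arbitrary: g)
  case 0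
  have "g differentiable (at (\<phi> y))" "\<phi> differentiable (at y)" if "y \<in> V" for y
    using 0 that assms(1-3)
    by (auto intro!: differentiable_coordinates simp: differentiable_on_eq_differentiable_at)
  then have "(\<lambda>y. g (\<phi> y)) differentiable (at y)" if "y \<in> V" for y
    using differentiable_compose[of g \<phi> y UNIV] that by blast
  then show ?case
    using assms(2) by (simp add: differentiable_on_eq_differentiable_at)
next
  case (Suc k)
  have "g differentiable_on U" "(\<lambda>y. \<phi> y $ i) differentiable_on V" for i
    using Suc.prems by (auto intro: k_smooth_on_differentiable)
  then have g: "g differentiable (at (\<phi> y))" and \<phi>: "(\<lambda>y. \<phi> y $ i) differentiable (at y)"
    if "y \<in> V" for y i
    using that assms(3) unfolding differentiable_on_eq_differentiable_at[OF assms(1)]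
      differentiable_on_eq_differentiable_at[OF assms(2)] by blast+
  have "k_smooth_on k (pd i g) U" for i
    using Suc.prems(1) by simp
  moreover have "k_smooth_on k (\<lambda>y. \<phi> y $ i) V" for i
    using Suc.prems(2) by (rule k_smooth_on_Suc_imp)
  ultimately have outer: "k_smooth_on k (\<lambda>y. pd i g (\<phi> y)) V" for i
    using Suc.IH[of "pd i g"] by blast
  have inner: "k_smooth_on k (pd a (\<lambda>y. \<phi> y $ i)) V" for a i
    using Suc.prems(2)[of i] by simp
  have "k_smooth_on k (pd a (\<lambda>y. g (\<phi> y))) V" for a
  proof (rule k_smooth_on_cong[OF assms(2), where f = "\<lambda>y. \<Sum>i\<in>UNIV. pd i g (\<phi> y) * pd a (\<lambda>y. \<phi> y $ i) y"])
    show "k_smooth_on k (\<lambda>y. \<Sum>i\<in>UNIV. pd i g (\<phi> y) * pd a (\<lambda>y. \<phi> y $ i) y) V"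
      by (rule k_smooth_on_sum[OF assms(2) k_smooth_on_mult[OF assms(2) outer inner]])
    show "(\<Sum>i\<in>UNIV. pd i g (\<phi> y) * pd a (\<lambda>y. \<phi> y $ i) y) = pd a (\<lambda>y. g (\<phi> y)) y" if "y \<in> V" for y
      by (rule pd_compose[OF g[OF that] \<phi>[OF that], symmetric])
  qed
  moreover have "(\<lambda>y. g (\<phi> y)) differentiable (at y)" if "y \<in> V" for y
    using differentiable_compose[OF g[OF that] differentiable_coordinates[OF \<phi>[OF that]]] .
  ultimately show ?case
    using assms(2) by (simp add: differentiable_on_eq_differentiable_at)
qed

lemma smooth_on_const: "smooth_on (\<lambda>x. c) U"
  by (simp add: smooth_on_iff_k_smooth_on k_smooth_on_const)

lemma smooth_on_mult: "open U \<Longrightarrow> smooth_on f U \<Longrightarrow> smooth_on g U \<Longrightarrow> smooth_on (\<lambda>x. f x * g x) U"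
  by (simp add: smooth_on_iff_k_smooth_on k_smooth_on_mult)

lemma smooth_on_sum:
  "open U \<Longrightarrow> (\<And>a. a \<in> A \<Longrightarrow> smooth_on (f a) U) \<Longrightarrow> smooth_on (\<lambda>x. \<Sum>a\<in>A. f a x) U"
  by (simp add: smooth_on_iff_k_smooth_on k_smooth_on_sum)

lemma smooth_on_compose:
  "open U \<Longrightarrow> open V \<Longrightarrow> \<phi> ` V \<subseteq> U \<Longrightarrow> smooth_on g U \<Longrightarrow> (\<And>i. smooth_on (\<lambda>y. \<phi> y $ i) V)
    \<Longrightarrow> smooth_on (\<lambda>y. g (\<phi> y)) V"
  unfolding smooth_on_iff_k_smooth_on
  by (intro allI k_smooth_on_compose[of U V \<phi> _ g]) simp_all

section \<open>Symmetry of mixed partial derivatives\<close>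

lemma mixed_difference_bound:
  assumes "open U" "x \<in> U" and g: "\<And>y. y \<in> U \<Longrightarrow> g differentiable (at y)"
    and dg: "pd i g differentiable (at x)" and "e > 0"
  shows "\<exists>\<delta>>0. \<forall>t. 0 < t \<and> t < \<delta> \<longrightarrow>
    \<bar>g (x + t *\<^sub>R axis i 1 + t *\<^sub>R axis j 1) - g (x + t *\<^sub>R axis i 1) - g (x + t *\<^sub>R axis j 1) + g x
       - t\<^sup>2 * pd j (pd i g) x\<bar> \<le> e * t\<^sup>2"
proof -
  let ?ei = "axis i (1::real)" and ?ej = "axis j (1::real)"
  obtain L where L: "(pd i g has_derivative L) (at x)"
    using dg unfolding differentiable_def by blast
  have Lj: "L ?ej = pd j (pd i g) x"
    using pd_eq[OF L] by simp
  obtain r where r: "r > 0" "ball x r \<subseteq> U"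
    using assms(1,2) openE by blast
  have "e / 3 > 0" using \<open>e > 0\<close> by simp
  then obtain d where d: "d > 0"
    "\<And>y. norm (y - x) < d \<Longrightarrow> norm (pd i g y - pd i g x - L (y - x)) \<le> e / 3 * norm (y - x)"
    using L unfolding has_derivative_at_alt by blast
  \<comment> \<open>Half, because points of the square of side \<open>t\<close> can be displaced by
    up to \<open>2 * t\<close>.\<close>
  define \<delta> where "\<delta> = min d r / 2"
  have "\<delta> > 0" using r d by (simp add: \<delta>_def)
  moreover have "\<bar>g (x + t *\<^sub>R ?ei + t *\<^sub>R ?ej) - g (x + t *\<^sub>R ?ei) - g (x + t *\<^sub>R ?ej) + g x
       - t\<^sup>2 * pd j (pd i g) x\<bar> \<le> e * t\<^sup>2" if t: "0 < t" "t < \<delta>" for t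
  proof -
    have near: "norm (s *\<^sub>R ?ei + u *\<^sub>R ?ej) \<le> s + u" if "0 \<le> s" "0 \<le> u" for s u
      using norm_triangle_ineq[of "s *\<^sub>R ?ei" "u *\<^sub>R ?ej"] that by (simp add: norm_axis_1)
    have inU: "x + s *\<^sub>R ?ei + u *\<^sub>R ?ej \<in> U" if "0 \<le> s" "s \<le> t" "0 \<le> u" "u \<le> t" for s u
    proof -
      have "norm (s *\<^sub>R ?ei + u *\<^sub>R ?ej) < r"
        using near[of s u] that t by (simp add: \<delta>_def)
      moreover have "x + z \<in> U" if "norm z < r" for z
        using r(2) that by (auto simp: dist_norm)
      ultimately show ?thesis by (metis add.assoc)
    qed
    have deriv: "((\<lambda>s. g (x + s *\<^sub>R ?ei + u *\<^sub>R ?ej)) has_field_derivative pd i g (x + s *\<^sub>R ?ei + u *\<^sub>R ?ej)) (at s)"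
      if inside: "x + s *\<^sub>R ?ei + u *\<^sub>R ?ej \<in> U" for s u
    proof -
      obtain g' where g': "(g has_derivative g') (at (x + s *\<^sub>R ?ei + u *\<^sub>R ?ej))"
        using g[OF inside] unfolding differentiable_def by blast
      have "((\<lambda>s. g (x + s *\<^sub>R ?ei + u *\<^sub>R ?ej)) has_derivative (\<lambda>h. g' (h *\<^sub>R ?ei))) (at s)"
        by (rule has_derivative_compose[where g = g and f = "\<lambda>s. x + s *\<^sub>R ?ei + u *\<^sub>R ?ej", OF _ g'])
          (auto intro!: derivative_eq_intros)
      moreover have "(\<lambda>h. g' (h *\<^sub>R ?ei)) = (*) (pd i g (x + s *\<^sub>R ?ei + u *\<^sub>R ?ej))"
        using has_derivative_linear[OF g'] by (auto simp: linear_scale pd_eq[OF g'])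
      ultimately show ?thesis by (simp add: has_field_derivative_def)
    qed
    \<comment> \<open>The mean value theorem is applied to the increment of \<open>g\<close> in
      direction \<open>j\<close>, viewed as a function of the step in direction \<open>i\<close>.
      What remains is an increment of \<open>pd i g\<close>, which is controlled by its Frechet
      derivative at the single point \<open>x\<close>.\<close>
    have "\<exists>s. 0 < s \<and> s < t \<and> (g (x + t *\<^sub>R ?ei + t *\<^sub>R ?ej) - g (x + t *\<^sub>R ?ei + 0 *\<^sub>R ?ej))
       - (g (x + 0 *\<^sub>R ?ei + t *\<^sub>R ?ej) - g (x + 0 *\<^sub>R ?ei + 0 *\<^sub>R ?ej)) =
      (t - 0) * (pd i g (x + s *\<^sub>R ?ei + t *\<^sub>R ?ej) - pd i g (x + s *\<^sub>R ?ei + 0 *\<^sub>R ?ej))"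
      by (rule MVT2[OF t(1)]) (intro DERIV_diff deriv inU; use t in simp)
    then obtain s where s: "0 < s" "s < t" and mvt:
      "g (x + t *\<^sub>R ?ei + t *\<^sub>R ?ej) - g (x + t *\<^sub>R ?ei) - g (x + t *\<^sub>R ?ej) + g x =
        t * (pd i g (x + s *\<^sub>R ?ei + t *\<^sub>R ?ej) - pd i g (x + s *\<^sub>R ?ei))"
      by (auto simp: algebra_simps)
    have b1: "\<bar>pd i g (x + s *\<^sub>R ?ei + t *\<^sub>R ?ej) - pd i g x - L (s *\<^sub>R ?ei + t *\<^sub>R ?ej)\<bar> \<le> e / 3 * (2 * t)"
    proof -
      have n: "norm (s *\<^sub>R ?ei + t *\<^sub>R ?ej) \<le> 2 * t" using near[of s t] s by simp
      then have "norm (s *\<^sub>R ?ei + t *\<^sub>R ?ej) < d" using t by (simp add: \<delta>_def)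
      then have "\<bar>pd i g (x + s *\<^sub>R ?ei + t *\<^sub>R ?ej) - pd i g x - L (s *\<^sub>R ?ei + t *\<^sub>R ?ej)\<bar>
         \<le> e / 3 * norm (s *\<^sub>R ?ei + t *\<^sub>R ?ej)"
        using d(2)[of "x + s *\<^sub>R ?ei + t *\<^sub>R ?ej"] by (simp add: add.assoc)
      also have "\<dots> \<le> e / 3 * (2 * t)"
        using n \<open>e > 0\<close> by (intro mult_left_mono) auto
      finally show ?thesis .
    qed
    have b2: "\<bar>pd i g (x + s *\<^sub>R ?ei) - pd i g x - L (s *\<^sub>R ?ei)\<bar> \<le> e / 3 * t"
    proof -
      have "\<bar>pd i g (x + s *\<^sub>R ?ei) - pd i g x - L (s *\<^sub>R ?ei)\<bar> \<le> e / 3 * norm (s *\<^sub>R ?ei)"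
        using d(2)[of "x + s *\<^sub>R ?ei"] s t by (simp add: norm_axis_1 \<delta>_def)
      also have "\<dots> \<le> e / 3 * t"
        using s \<open>e > 0\<close> by (intro mult_left_mono) (auto simp: norm_axis_1)
      finally show ?thesis .
    qed
    have "L (s *\<^sub>R ?ei + t *\<^sub>R ?ej) = L (s *\<^sub>R ?ei) + t * L ?ej"
      using has_derivative_linear[OF L] by (simp add: linear_add linear_scale)
    \<comment> \<open>The errors \<open>e / 3 * (2 * t)\<close> and \<open>e / 3 * t\<close> add up
      to \<open>e * t\<close>; hence the tolerance \<open>e / 3\<close> above.\<close>
    with b1 b2 have "\<bar>(pd i g (x + s *\<^sub>R ?ei + t *\<^sub>R ?ej) - pd i g (x + s *\<^sub>R ?ei)) - t * L ?ej\<bar> \<le> e * t"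
      by linarith
    then have "t * \<bar>(pd i g (x + s *\<^sub>R ?ei + t *\<^sub>R ?ej) - pd i g (x + s *\<^sub>R ?ei)) - t * L ?ej\<bar> \<le> t * (e * t)"
      using t by (intro mult_left_mono) auto
    moreover have "t * \<bar>(pd i g (x + s *\<^sub>R ?ei + t *\<^sub>R ?ej) - pd i g (x + s *\<^sub>R ?ei)) - t * L ?ej\<bar> =
      \<bar>t * (pd i g (x + s *\<^sub>R ?ei + t *\<^sub>R ?ej) - pd i g (x + s *\<^sub>R ?ei)) - t\<^sup>2 * L ?ej\<bar>"
      using t by (simp add: abs_mult_pos' power2_eq_square right_diff_distrib mult.assoc)
    ultimately show ?thesis
      unfolding mvt Lj[symmetric] by (simp add: power2_eq_square mult_ac)
  qed
  ultimately show ?thesis by blast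
qed

text \<open>The second difference over a square is symmetric in the two directions, and divided by
  \<open>t^2\<close> it tends to either mixed derivative.\<close>

lemma pd_commute:
  assumes "open U" "x \<in> U" and g: "\<And>y. y \<in> U \<Longrightarrow> g differentiable (at y)"
    and "pd i g differentiable (at x)" "pd j g differentiable (at x)"
  shows "pd i (pd j g) x = pd j (pd i g) x"
proof (rule ccontr)
  assume "pd i (pd j g) x \<noteq> pd j (pd i g) x"
  \<comment> \<open>With a third of the gap, two errors of size \<open>e * t^2\<close> cannot bridge
    a gap of \<open>3 * e * t^2\<close>.\<close>
  define e where "e = \<bar>pd i (pd j g) x - pd j (pd i g) x\<bar> / 3"
  have "e > 0" using \<open>pd i (pd j g) x \<noteq> pd j (pd i g) x\<close> by (simp add: e_def)
  from mixed_difference_bound[OF assms(1-3,4) this] mixed_difference_bound[OF assms(1-3,5) this]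
  obtain d1 d2 where d: "d1 > 0" "d2 > 0"
    "\<And>t. 0 < t \<Longrightarrow> t < d1 \<Longrightarrow> \<bar>g (x + t *\<^sub>R axis i 1 + t *\<^sub>R axis j 1) - g (x + t *\<^sub>R axis i 1) - g (x + t *\<^sub>R axis j 1) + g x
       - t\<^sup>2 * pd j (pd i g) x\<bar> \<le> e * t\<^sup>2"
    "\<And>t. 0 < t \<Longrightarrow> t < d2 \<Longrightarrow> \<bar>g (x + t *\<^sub>R axis j 1 + t *\<^sub>R axis i 1) - g (x + t *\<^sub>R axis j 1) - g (x + t *\<^sub>R axis i 1) + g x
       - t\<^sup>2 * pd i (pd j g) x\<bar> \<le> e * t\<^sup>2"
    by metis
  define t where "t = min d1 d2 / 2"
  have t: "0 < t" "t < d1" "t < d2" using d by (auto simp: t_def)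
  have swap: "x + t *\<^sub>R axis j 1 + t *\<^sub>R axis i 1 = x + t *\<^sub>R axis i 1 + t *\<^sub>R axis j 1"
    by (simp add: add_ac)
  have "\<bar>t\<^sup>2 * pd i (pd j g) x - t\<^sup>2 * pd j (pd i g) x\<bar> \<le> e * t\<^sup>2 + e * t\<^sup>2"
    using d(3)[OF t(1,2)] d(4)[OF t(1,3)] unfolding swap by linarith
  moreover have "\<bar>t\<^sup>2 * pd i (pd j g) x - t\<^sup>2 * pd j (pd i g) x\<bar> = t\<^sup>2 * (3 * e)"
    unfolding right_diff_distrib[symmetric] abs_mult e_def by simp
  ultimately have "t\<^sup>2 * (3 * e) \<le> t\<^sup>2 * (2 * e)" by (simp add: mult_ac)
  then show False using t \<open>e > 0\<close> by simp
qed

lemma smooth_on_pd_commute: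
  assumes "open U" "smooth_on g U" "x \<in> U"
  shows "pd i (pd j g) x = pd j (pd i g) x"
  using assms by (intro pd_commute[of U] smooth_on_differentiable[of _ U] smooth_on_pd)

section \<open>Differentiability of determinants\<close>

lemma differentiable_prod:
  fixes f :: "'a \<Rightarrow> 'b::real_normed_vector \<Rightarrow> real"
  assumes "\<And>i. i \<in> A \<Longrightarrow> f i differentiable (at x)"
  shows "(\<lambda>x. \<Prod>i\<in>A. f i x) differentiable (at x)"
  using assms by (induction A rule: infinite_finite_induct) auto

lemma differentiable_det:
  fixes G :: "'a::real_normed_vector \<Rightarrow> real^'n^'n"
  assumes "\<And>i j. (\<lambda>x. G x $ i $ j) differentiable (at x)"
  shows "(\<lambda>x. det (G x)) differentiable (at x)"
proof -
  have "(\<lambda>x. \<Prod>i\<in>UNIV. G x $ i $ p i) differentiable (at x)" for p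
    by (rule differentiable_prod) (rule assms)
  then show ?thesis
    unfolding det_def by (intro differentiable_sum differentiable_mult differentiable_const) simp_all
qed

section \<open>Covariance of the Clebsch form\<close>

text \<open>The quartic Aronhold invariant of a ternary cubic, up to normalisation, detached from
  \<open>f\<close> so that it can be evaluated on the derivative of the metric and in other frames.
  Each symmetric entry is read at its sorted index triple.\<close>

definition clebsch_form :: "(3 \<Rightarrow> 3 \<Rightarrow> 3 \<Rightarrow> real) \<Rightarrow> real" where
  "clebsch_form F =
    (let a3 = F 3 3 3; a2 = F 1 3 3; b2 = F 2 3 3;
         a1 = F 1 1 3; b1 = F 1 2 3; c1 = F 2 2 3;
         a0 = F 1 1 1; b0 = F 1 1 2; c0 = F 1 2 2; d0 = F 2 2 2
     in - (a0*a2 - a1^2)*c1^2 + (a0*a3 - a1*a2)*c0*c1 - (a1*a3 - a2^2)*c0^2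
        - b0^2*a3*c1 + b0*b1*(3*a2*c1 + a3*c0)
        - (b0*b2 + 2*b1^2)*(a1*c1 + a2*c0)
        + b1*b2*(a0*c1 + 3*a1*c0) - b2^2*a0*c0
        + d0*(b0*(a1*a3 - a2^2) - b1*(a0*a3 - a1*a2) + b2*(a0*a2 - a1^2))
        + (b0*b2 - b1^2)^2)"

definition sym3 :: "('n \<Rightarrow> 'n \<Rightarrow> 'n \<Rightarrow> real) \<Rightarrow> bool" where
  "sym3 F \<longleftrightarrow> (\<forall>i j k. F i j k = F j i k \<and> F i j k = F i k j)"

text \<open>These are the coefficients of the cubic in the frame formed by the columns of
  \<open>A\<close>.\<close>

definition subst_form :: "real^'n^'n \<Rightarrow> ('n::finite \<Rightarrow> 'n \<Rightarrow> 'n \<Rightarrow> real) \<Rightarrow> 'n \<Rightarrow> 'n \<Rightarrow> 'n \<Rightarrow> real" where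
  "subst_form A F i j k = (\<Sum>a\<in>UNIV. \<Sum>b\<in>UNIV. \<Sum>c\<in>UNIV. F a b c * A$a$i * A$b$j * A$c$k)"

lemma sym3_swaps:
  assumes "sym3 F"
  shows "F i j k = F j i k" "F i j k = F i k j"
  using assms unfolding sym3_def by blast+

lemma sym3_subst_form:
  assumes "sym3 F"
  shows "sym3 (subst_form A F)"
proof -
  have "subst_form A F i j k = subst_form A F j i k" for i j k
    unfolding subst_form_def
    by (subst sum.swap) (intro sum.cong refl, simp add: sym3_swaps(1)[OF assms] mult_ac)
  moreover have "subst_form A F i j k = subst_form A F i k j" for i j k
    unfolding subst_form_def
    by (rule sum.cong[OF refl], subst sum.swap) (intro sum.cong refl, simp add: sym3_swaps(2)[OF assms] mult_ac)
  ultimately show ?thesis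
    unfolding sym3_def by blast
qed

lemma sum_swap_triple:
  "(\<Sum>a\<in>A. \<Sum>x\<in>X. \<Sum>y\<in>Y. \<Sum>z\<in>Z. g a x y z) = (\<Sum>x\<in>X. \<Sum>y\<in>Y. \<Sum>z\<in>Z. \<Sum>a\<in>A. g a x y z)"
  for g :: "'a \<Rightarrow> 'b \<Rightarrow> 'c \<Rightarrow> 'd \<Rightarrow> 'e::comm_monoid_add"
proof -
  have "(\<Sum>a\<in>A. \<Sum>x\<in>X. \<Sum>y\<in>Y. \<Sum>z\<in>Z. g a x y z) = (\<Sum>x\<in>X. \<Sum>a\<in>A. \<Sum>y\<in>Y. \<Sum>z\<in>Z. g a x y z)"
    by (rule sum.swap)
  also have "\<dots> = (\<Sum>x\<in>X. \<Sum>y\<in>Y. \<Sum>a\<in>A. \<Sum>z\<in>Z. g a x y z)"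
    by (intro sum.cong refl sum.swap)
  also have "\<dots> = (\<Sum>x\<in>X. \<Sum>y\<in>Y. \<Sum>z\<in>Z. \<Sum>a\<in>A. g a x y z)"
    by (intro sum.cong refl sum.swap)
  finally show ?thesis .
qed

text \<open>Substitution is a right action, so a covariance law has to be checked on generating
  matrices only.\<close>

lemma subst_form_mult: "subst_form (A ** B) F = subst_form B (subst_form A F)"
proof (intro ext)
  fix i j k
  let ?g = "\<lambda>a b c x y z. F a b c * A$a$x * A$b$y * A$c$z * B$x$i * B$y$j * B$z$k"
  have "subst_form (A ** B) F i j k =
    (\<Sum>a\<in>UNIV. \<Sum>b\<in>UNIV. \<Sum>c\<in>UNIV. \<Sum>x\<in>UNIV. \<Sum>y\<in>UNIV. \<Sum>z\<in>UNIV. ?g a b c x y z)"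
    unfolding subst_form_def matrix_matrix_mult_def
    by (simp add: sum_distrib_left sum_distrib_right mult_ac)
  also have "\<dots> = (\<Sum>a\<in>UNIV. \<Sum>b\<in>UNIV. \<Sum>x\<in>UNIV. \<Sum>y\<in>UNIV. \<Sum>z\<in>UNIV. \<Sum>c\<in>UNIV. ?g a b c x y z)"
    by (intro sum.cong refl sum_swap_triple)
  also have "\<dots> = (\<Sum>a\<in>UNIV. \<Sum>x\<in>UNIV. \<Sum>y\<in>UNIV. \<Sum>z\<in>UNIV. \<Sum>b\<in>UNIV. \<Sum>c\<in>UNIV. ?g a b c x y z)"
    by (intro sum.cong refl sum_swap_triple)
  also have "\<dots> = (\<Sum>x\<in>UNIV. \<Sum>y\<in>UNIV. \<Sum>z\<in>UNIV. \<Sum>a\<in>UNIV. \<Sum>b\<in>UNIV. \<Sum>c\<in>UNIV. ?g a b c x y z)"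
    by (rule sum_swap_triple)
  also have "\<dots> = subst_form B (subst_form A F) i j k"
    unfolding subst_form_def by (simp add: sum_distrib_left sum_distrib_right mult_ac)
  finally show "subst_form (A ** B) F i j k = subst_form B (subst_form A F) i j k" .
qed

text \<open>Sends the 17 unsorted entries to the ten sorted ones, after which the covariance
  identities are plain polynomial identities.\<close>

lemma sym3_3:
  fixes F :: "3 \<Rightarrow> 3 \<Rightarrow> 3 \<Rightarrow> real"
  assumes "sym3 F"
  shows "F 1 2 1 = F 1 1 2" "F 2 1 1 = F 1 1 2" "F 1 3 1 = F 1 1 3" "F 3 1 1 = F 1 1 3"
    "F 2 1 2 = F 1 2 2" "F 2 2 1 = F 1 2 2" "F 3 1 3 = F 1 3 3" "F 3 3 1 = F 1 3 3"
    "F 2 3 2 = F 2 2 3" "F 3 2 2 = F 2 2 3" "F 3 2 3 = F 2 3 3" "F 3 3 2 = F 2 3 3"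
    "F 1 3 2 = F 1 2 3" "F 2 1 3 = F 1 2 3" "F 2 3 1 = F 1 2 3" "F 3 1 2 = F 1 2 3" "F 3 2 1 = F 1 2 3"
  using assms unfolding sym3_def by metis+

text \<open>The law is compatible with products, so it suffices to treat diagonal matrices,
  transpositions and shears. The exponent is forced by scaling: a scalar matrix \<open>t\<close>
  multiplies the cubic by \<open>t^3\<close> and hence the quartic invariant by \<open>t^12\<close>,
  while the determinant is \<open>t^3\<close>.\<close>

lemma clebsch_form_subst:
  assumes "sym3 F" "det A \<noteq> 0"
  shows "clebsch_form (subst_form A F) = det A ^ 4 * clebsch_form F"
proof -
  \<comment> \<open>\<open>F\<close> is quantified inside the induction because in the product case
    one hypothesis is applied to the cubic already transformed by the other factor.\<close>
  have "\<forall>F. sym3 F \<longrightarrow> det A \<noteq> 0 \<longrightarrow> clebsch_form (subst_form A F) = det A ^ 4 * clebsch_form F"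
  proof (induction A rule: induct_matrix_elementary_alt)
    case (1 A B)
    then show ?case
      by (simp add: subst_form_mult det_mul sym3_subst_form power_mult_distrib)
  next
    case (2 A i)
    then show ?case using det_zero_row(1) by blast
  next
    case (3 A)
    then have A: "A$1$2=0" "A$1$3=0" "A$2$1=0" "A$2$3=0" "A$3$1=0" "A$3$2=0" by simp_all
    show ?case
    proof (intro allI impI)
      fix F :: "3 \<Rightarrow> 3 \<Rightarrow> 3 \<Rightarrow> real"
      assume F: "sym3 F"
      show "clebsch_form (subst_form A F) = det A ^ 4 * clebsch_form F"
        unfolding clebsch_form_def subst_form_def Let_def det_3 sum_3 A sym3_3[OF F]
        by (simp add: algebra_simps power2_eq_square power4_eq_xxxx)
    qed
  next
    case (4 m n)
    show ?case
    proof (intro allI impI)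
      fix F :: "3 \<Rightarrow> 3 \<Rightarrow> 3 \<Rightarrow> real"
      assume F: "sym3 F"
      show "clebsch_form (subst_form (\<chi> i j. mat 1 $ i $ Transposition.transpose m n j) F)
        = det (\<chi> i j. mat 1 $ i $ Transposition.transpose m n j) ^ 4 * clebsch_form F"
        using exhaust_3[of m] exhaust_3[of n] 4
        apply (elim disjE)
        apply (simp_all add: clebsch_form_def subst_form_def Let_def det_3 sum_3 sym3_3[OF F] mat_def Transposition.transpose_def)
        by (simp_all add: algebra_simps power2_eq_square)
    qed
  next
    case (5 m n)
    show ?case
    proof (intro allI impI)
      fix F :: "3 \<Rightarrow> 3 \<Rightarrow> 3 \<Rightarrow> real"
      assume F: "sym3 F"
      show "clebsch_form (subst_form (\<chi> i j. of_bool (i = m \<and> j = n \<or> i = j)) F)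
        = det (\<chi> i j. of_bool (i = m \<and> j = n \<or> i = j)) ^ 4 * clebsch_form F"
        using exhaust_3[of m] exhaust_3[of n] 5
        apply (elim disjE)
        apply (simp_all add: clebsch_form_def subst_form_def Let_def det_3 sum_3 sym3_3[OF F])
        by (simp_all add: algebra_simps power2_eq_square)
    qed
  qed
  with assms show ?thesis by blast
qed

section \<open>The Clebsch form in an adapted frame\<close>

lemma invertible_matrix_inv:
  fixes M :: "real^'n^'n"
  assumes "det M \<noteq> 0"
  shows "M ** matrix_inv M = mat 1" "matrix_inv M ** M = mat 1"
proof -
  have "\<exists>M'. M ** M' = mat 1 \<and> M' ** M = mat 1"
    using assms invertible_det_nz[of M] unfolding invertible_def by blast
  from someI_ex[OF this] show "M ** matrix_inv M = mat 1" "matrix_inv M ** M = mat 1"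
    unfolding matrix_inv_def by auto
qed

definition contract3 :: "('n::finite \<Rightarrow> 'n \<Rightarrow> 'n \<Rightarrow> real) \<Rightarrow> real^'n \<Rightarrow> real^'n \<Rightarrow> real^'n" where
  "contract3 F v w = (\<chi> k. \<Sum>i\<in>UNIV. \<Sum>j\<in>UNIV. F i j k * v$i * w$j)"

lemma subst_form_contract3:
  "subst_form A F i j k = contract3 F (column i A) (column j A) \<bullet> column k A"
proof -
  have "contract3 F (column i A) (column j A) \<bullet> column k A =
      (\<Sum>c\<in>UNIV. \<Sum>a\<in>UNIV. \<Sum>b\<in>UNIV. F a b c * A$a$i * A$b$j * A$c$k)"
    by (simp add: contract3_def inner_vec_def column_def sum_distrib_right)
  also have "\<dots> = (\<Sum>a\<in>UNIV. \<Sum>c\<in>UNIV. \<Sum>b\<in>UNIV. F a b c * A$a$i * A$b$j * A$c$k)"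
    by (rule sum.swap)
  also have "\<dots> = subst_form A F i j k"
    unfolding subst_form_def by (intro sum.cong refl sum.swap)
  finally show ?thesis by simp
qed

definition frame3 :: "real^3 \<Rightarrow> real^3 \<Rightarrow> real^3 \<Rightarrow> real^3^3" where
  "frame3 p v w = (\<chi> i j. if j = 1 then p$i else if j = 2 then v$i else w$i)"

lemma column_frame3:
  "column 1 (frame3 p v w) = p" "column 2 (frame3 p v w) = v" "column 3 (frame3 p v w) = w"
  by (simp_all add: column_def frame3_def vec_eq_iff)

text \<open>Spanning is the form in which the frame is available, since \<open>v\<close> and
  \<open>w\<close> are known through the plane they span; it makes the matrix surjective and hence
  invertible.\<close>

lemma det_frame3_nonzero:
  assumes "\<And>u. \<exists>r s t. u = r *\<^sub>R p + s *\<^sub>R v + t *\<^sub>R w"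
  shows "det (frame3 p v w) \<noteq> 0"
proof -
  have "\<exists>x. u = frame3 p v w *v x" for u
  proof -
    obtain r s t where "u = r *\<^sub>R p + s *\<^sub>R v + t *\<^sub>R w"
      using assms by blast
    then have "u = frame3 p v w *v vector [r, s, t]"
      by (simp add: matrix_vector_mult_def frame3_def vec_eq_iff sum_3)
    then show ?thesis ..
  qed
  then have "surj ((*v) (frame3 p v w))"
    by (rule surjI[OF someI_ex[THEN sym]])
  then have "invertible (frame3 p v w)"
    unfolding matrix_right_invertible_surjective[symmetric] invertible_right_inverse .
  then show ?thesis
    by (simp add: invertible_det_nz)
qed

lemma symmetric_form_swap:
  fixes H :: "real^'n^'n"
  assumes "transpose H = H"
  shows "x \<bullet> (H *v y) = y \<bullet> (H *v x)"
  by (metis assms dot_lmul_matrix inner_commute transpose_matrix_vector)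

text \<open>The Gram matrix of the frame is \<open>transpose A ** H ** A\<close>. Orthogonality
  makes it block diagonal, so its determinant splits into a normal and a tangential factor.\<close>

lemma gram_det:
  fixes H :: "real^3^3"
  assumes "transpose H = H" "p \<bullet> (H *v v) = 0" "p \<bullet> (H *v w) = 0"
  shows "(det (frame3 p v w))\<^sup>2 * det H =
    (p \<bullet> (H *v p)) * ((v \<bullet> (H *v v)) * (w \<bullet> (H *v w)) - (v \<bullet> (H *v w))\<^sup>2)"
proof -
  let ?A = "frame3 p v w"
  have entry: "(transpose ?A ** H ** ?A) $ i $ j = column i ?A \<bullet> (H *v column j ?A)" for i j
    by (simp add: matrix_matrix_mult_def matrix_vector_mult_def inner_vec_def transpose_def column_def
       sum_3 algebra_simps)
  have "det (transpose ?A ** H ** ?A) =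
     (p \<bullet> (H *v p)) * ((v \<bullet> (H *v v)) * (w \<bullet> (H *v w)) - (v \<bullet> (H *v w))\<^sup>2)"
    unfolding det_3 entry column_frame3
    using assms(2,3) symmetric_form_swap[OF assms(1)]
    by (simp add: algebra_simps power2_eq_square)
  moreover have "det (transpose ?A ** H ** ?A) = (det ?A)\<^sup>2 * det H"
    by (simp add: det_mul power2_eq_square)
  ultimately show ?thesis by simp
qed

text \<open>The inverse of the block diagonal Gram matrix is \<open>1 / P\<close> on the normal line
  plus the adjugate of the tangential block divided by \<open>D\<close>. This separates normal from
  tangential contributions both in the ambient curvature and in the Gauss equation.\<close>

lemma inverse_form_orthogonal_frame:
  fixes H :: "real^3^3"
  assumes H: "transpose H = H" "det H \<noteq> 0"
    and orth: "p \<bullet> (H *v v) = 0" "p \<bullet> (H *v w) = 0"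
    and span: "\<And>u. \<exists>r s t. u = r *\<^sub>R p + s *\<^sub>R v + t *\<^sub>R w"
  defines "P \<equiv> p \<bullet> (H *v p)"
    and "D \<equiv> (v \<bullet> (H *v v)) * (w \<bullet> (H *v w)) - (v \<bullet> (H *v w))\<^sup>2"
  shows "P \<noteq> 0" "D \<noteq> 0"
    "\<alpha> \<bullet> (matrix_inv H *v \<beta>) = (\<alpha> \<bullet> p) * (\<beta> \<bullet> p) / P +
       ((\<alpha> \<bullet> v) * (\<beta> \<bullet> v) * (w \<bullet> (H *v w)) - ((\<alpha> \<bullet> v) * (\<beta> \<bullet> w) + (\<alpha> \<bullet> w) * (\<beta> \<bullet> v)) * (v \<bullet> (H *v w))
         + (\<alpha> \<bullet> w) * (\<beta> \<bullet> w) * (v \<bullet> (H *v v))) / D"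
proof -
  have "(det (frame3 p v w))\<^sup>2 * det H = P * D"
    unfolding P_def D_def by (rule gram_det[OF H(1) orth])
  with H(2) det_frame3_nonzero[OF span] show P: "P \<noteq> 0" and D: "D \<noteq> 0"
    by auto
  obtain r s t where x: "matrix_inv H *v \<beta> = r *\<^sub>R p + s *\<^sub>R v + t *\<^sub>R w"
    using span by blast
  have "H *v (matrix_inv H *v \<beta>) = \<beta>"
    by (simp add: matrix_vector_mul_assoc invertible_matrix_inv[OF H(2)])
  then have \<beta>: "\<beta> = r *\<^sub>R (H *v p) + s *\<^sub>R (H *v v) + t *\<^sub>R (H *v w)"
    unfolding x by (simp add: matrix_vector_right_distrib matrix_vector_mult_scaleR)
  define a b c where abc: "a = v \<bullet> (H *v v)" "b = v \<bullet> (H *v w)" "c = w \<bullet> (H *v w)"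
  have sw: "w \<bullet> (H *v v) = b" "v \<bullet> (H *v p) = 0" "w \<bullet> (H *v p) = 0"
    using symmetric_form_swap[OF H(1)] orth abc by auto
  \<comment> \<open>Pairing with the frame yields \<open>r\<close> directly and a linear system for
    \<open>s\<close> and \<open>t\<close> with determinant \<open>D\<close>.\<close>
  have p: "\<beta> \<bullet> p = r * P" and v: "\<beta> \<bullet> v = s * a + t * b" and w: "\<beta> \<bullet> w = s * b + t * c"
    unfolding \<beta> P_def using orth sw abc
    by (simp_all add: inner_left_distrib inner_commute[of "H *v _"])
  have D': "D = a * c - b\<^sup>2" by (simp add: D_def abc)
  have "\<alpha> \<bullet> (matrix_inv H *v \<beta>) = r * (\<alpha> \<bullet> p) + s * (\<alpha> \<bullet> v) + t * (\<alpha> \<bullet> w)"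
    unfolding x by (simp add: inner_right_distrib)
  also have "r * (\<alpha> \<bullet> p) = (\<alpha> \<bullet> p) * (\<beta> \<bullet> p) / P"
    using P p by simp
  also have "(\<alpha> \<bullet> p) * (\<beta> \<bullet> p) / P + s * (\<alpha> \<bullet> v) + t * (\<alpha> \<bullet> w) = (\<alpha> \<bullet> p) * (\<beta> \<bullet> p) / P +
      (s * (\<alpha> \<bullet> v) + t * (\<alpha> \<bullet> w))" by simp
  also have "s * (\<alpha> \<bullet> v) + t * (\<alpha> \<bullet> w) = ((\<alpha> \<bullet> v) * (\<beta> \<bullet> v) * c - ((\<alpha> \<bullet> v) * (\<beta> \<bullet> w) + (\<alpha> \<bullet> w) * (\<beta> \<bullet> v)) * b
         + (\<alpha> \<bullet> w) * (\<beta> \<bullet> w) * a) / D"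
    using D unfolding v w D' by (simp add: field_simps power2_eq_square)
  finally show "\<alpha> \<bullet> (matrix_inv H *v \<beta>) = (\<alpha> \<bullet> p) * (\<beta> \<bullet> p) / P +
       ((\<alpha> \<bullet> v) * (\<beta> \<bullet> v) * (w \<bullet> (H *v w)) - ((\<alpha> \<bullet> v) * (\<beta> \<bullet> w) + (\<alpha> \<bullet> w) * (\<beta> \<bullet> v)) * (v \<bullet> (H *v w))
         + (\<alpha> \<bullet> w) * (\<beta> \<bullet> w) * (v \<bullet> (H *v v))) / D"
    unfolding abc .
qed

lemma contract3_swap:
  assumes "sym3 F"
  shows "contract3 F v w = contract3 F w v" "contract3 F v w \<bullet> u = contract3 F v u \<bullet> w"
proof -
  show "contract3 F v w = contract3 F w v"
    unfolding contract3_def vec_eq_iff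
    by (subst sum.swap) (simp add: sym3_swaps(1)[OF assms] mult_ac)
  have "(\<Sum>k\<in>UNIV. \<Sum>i\<in>UNIV. \<Sum>j\<in>UNIV. F i j k * v$i * w$j * u$k) = (\<Sum>i\<in>UNIV. \<Sum>k\<in>UNIV. \<Sum>j\<in>UNIV. F i j k * v$i * w$j * u$k)"
    by (rule sum.swap)
  also have "\<dots> = (\<Sum>i\<in>UNIV. \<Sum>j\<in>UNIV. \<Sum>k\<in>UNIV. F i j k * v$i * w$j * u$k)"
    by (intro sum.cong refl sum.swap)
  also have "\<dots> = (\<Sum>j\<in>UNIV. \<Sum>i\<in>UNIV. \<Sum>k\<in>UNIV. F i k j * v$i * u$k * w$j)"
    by (subst sum.swap) (intro sum.cong refl, simp add: sym3_swaps(2)[OF assms] mult_ac)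
  finally show "contract3 F v w \<bullet> u = contract3 F v u \<bullet> w"
    by (simp add: contract3_def inner_vec_def sum_distrib_right)
qed

text \<open>Both sides are read off in the frame \<open>p, v, w\<close>: since \<open>F\<close> contracted with \<open>p\<close> is a multiple
  of \<open>H\<close>, the coefficients \<open>a\<^sub>1\<close> and \<open>b\<^sub>0\<close> of the transformed cubic vanish there.\<close>
lemma clebsch_form_eq_curvature_form:
  fixes H :: "real^3^3"
  assumes F: "sym3 F" and H: "transpose H = H" "det H \<noteq> 0"
    and orth: "p \<bullet> (H *v v) = 0" "p \<bullet> (H *v w) = 0"
    and span: "\<And>u. \<exists>r s t. u = r *\<^sub>R p + s *\<^sub>R v + t *\<^sub>R w"
    and euler: "\<And>x y. contract3 F x y \<bullet> p = e * (x \<bullet> (H *v y))"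
  shows "e\<^sup>2 * (det H)\<^sup>2 * (contract3 F v v \<bullet> (matrix_inv H *v contract3 F w w)
              - contract3 F v w \<bullet> (matrix_inv H *v contract3 F v w)) =
     clebsch_form F * (p \<bullet> (H *v p)) * ((v \<bullet> (H *v v)) * (w \<bullet> (H *v w)) - (v \<bullet> (H *v w))\<^sup>2)"
    (is "e\<^sup>2 * (det H)\<^sup>2 * ?J = _")
proof -
  define A where "A = frame3 p v w"
  define P where "P = p \<bullet> (H *v p)"
  define a b c where abc: "a = v \<bullet> (H *v v)" "b = v \<bullet> (H *v w)" "c = w \<bullet> (H *v w)"
  define D where "D = a * c - b\<^sup>2"
  define d0 c1 b2 a3 where F': "d0 = contract3 F v v \<bullet> v" "c1 = contract3 F v v \<bullet> w"
     "b2 = contract3 F w w \<bullet> v" "a3 = contract3 F w w \<bullet> w"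
  note inv = inverse_form_orthogonal_frame[OF H orth span, folded abc, folded D_def P_def]
  have P: "P \<noteq> 0" and D: "D \<noteq> 0" by (fact inv)+
  have detA: "det A \<noteq> 0" unfolding A_def by (rule det_frame3_nonzero[OF span])
  have gram: "(det A)\<^sup>2 * det H = P * D"
    unfolding A_def P_def D_def abc by (rule gram_det[OF H(1) orth])
  have sw: "contract3 F v w \<bullet> v = c1" "contract3 F v w \<bullet> w = b2"
    unfolding F' using contract3_swap[OF F] by metis+
  \<comment> \<open>The components along \<open>p\<close> are \<open>e * a\<close>,
    \<open>e * b\<close>, \<open>e * c\<close> by \<open>euler\<close>, so the normal part collapses
    to \<open>e^2 * D / P\<close>; the rest is the tangential part.\<close>
  have J: "?J = e\<^sup>2 * D / P + (d0 * b2 * c - (d0 * a3 + c1 * b2) * b + c1 * a3 * a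
       - (c1\<^sup>2 * c - 2 * c1 * b2 * b + b2\<^sup>2 * a)) / D"
  proof -
    have "e\<^sup>2 * D / P = (e * a) * (e * c) / P - (e * b) * (e * b) / P"
      by (simp add: D_def power2_eq_square right_diff_distrib diff_divide_distrib mult_ac)
    then show ?thesis
      unfolding inv(3) euler F'[symmetric] sw abc[symmetric]
      by (simp add: add_divide_distrib diff_divide_distrib power2_eq_square algebra_simps)
  qed
  \<comment> \<open>The six entries with an index 1 are values of \<open>e\<close> times
    \<open>H\<close>; the other four are the tangential cubic.\<close>
  have coeffs: "subst_form A F 3 3 3 = a3" "subst_form A F 1 3 3 = e * c" "subst_form A F 2 3 3 = b2"
    "subst_form A F 1 1 3 = 0" "subst_form A F 1 2 3 = e * b" "subst_form A F 2 2 3 = c1"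
    "subst_form A F 1 1 1 = e * P" "subst_form A F 1 1 2 = 0" "subst_form A F 1 2 2 = e * a"
    "subst_form A F 2 2 2 = d0"
    unfolding subst_form_contract3 A_def column_frame3 F' abc P_def
    using contract3_swap[OF F] euler orth by (metis mult_zero_right)+
  have "clebsch_form (subst_form A F) = e\<^sup>2 * P * D * ?J"
  proof -
    define Y where "Y = d0 * b2 * c - (d0 * a3 + c1 * b2) * b + c1 * a3 * a
       - (c1\<^sup>2 * c - 2 * c1 * b2 * b + b2\<^sup>2 * a)"
    have "e\<^sup>2 * P * D * ?J = e ^ 4 * D\<^sup>2 + e\<^sup>2 * P * Y"
      unfolding J Y_def[symmetric] using P D by (simp add: field_simps power2_eq_square power4_eq_xxxx)
    then show ?thesis
      unfolding clebsch_form_def Let_def coeffs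
      by (simp add: D_def Y_def power2_eq_square power4_eq_xxxx algebra_simps)
  qed
  with clebsch_form_subst[OF F detA] have S: "det A ^ 4 * clebsch_form F = e\<^sup>2 * P * D * ?J"
    by simp
  \<comment> \<open>The factor \<open>det A ^ 4\<close> turns \<open>(det H)^2\<close> into
    \<open>(P * D)^2\<close> by the Gram identity and is also the covariance factor of the
    invariant, so it cancels in the end.\<close>
  have "det A ^ 4 * (e\<^sup>2 * (det H)\<^sup>2 * ?J) = e\<^sup>2 * ((det A)\<^sup>2 * det H)\<^sup>2 * ?J"
    by (simp add: power_mult_distrib)
  also have "\<dots> = P * D * (e\<^sup>2 * P * D * ?J)"
    unfolding gram by (simp add: power2_eq_square)
  also have "\<dots> = det A ^ 4 * (clebsch_form F * P * D)"
    unfolding S[symmetric] by simp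
  finally show ?thesis
    using detA by (simp add: P_def D_def abc)
qed

section \<open>Christoffel symbols and curvature of a smooth metric\<close>

text \<open>\<open>matrix_inv\<close> is defined by choice; Cramer's rule exhibits its entries as
  quotients of determinants, from which differentiability and the 2 by 2 inverse are read
  off.\<close>

lemma matrix_inv_cramer:
  fixes M :: "real^'n^'n"
  assumes "det M \<noteq> 0"
  shows "matrix_inv M $ k $ l = det (\<chi> i j. if j = k then axis l 1 $ i else M $ i $ j) / det M"
proof -
  have "M *v (matrix_inv M *v axis l 1) = axis l 1"
    by (simp add: matrix_vector_mul_assoc invertible_matrix_inv[OF assms])
  then have "matrix_inv M *v axis l 1 = (\<chi> k. det (\<chi> i j. if j = k then axis l 1 $ i else M $ i $ j) / det M)"
    unfolding cramer[OF assms] .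
  then have "(matrix_inv M *v axis l 1) $ k = det (\<chi> i j. if j = k then axis l 1 $ i else M $ i $ j) / det M"
    by simp
  then show ?thesis by (simp add: matrix_vector_mul_component cart_eq_inner_axis[symmetric])
qed

lemma differentiable_matrix_inv:
  fixes G :: "'a::real_normed_vector \<Rightarrow> real^'n^'n"
  assumes "open U" "x \<in> U" "\<And>y. y \<in> U \<Longrightarrow> det (G y) \<noteq> 0"
    and G: "\<And>i j. (\<lambda>x. G x $ i $ j) differentiable (at x)"
  shows "(\<lambda>y. matrix_inv (G y) $ k $ l) differentiable (at x)"
proof -
  let ?c = "\<lambda>y. det (\<chi> i j. if j = k then axis l 1 $ i else G y $ i $ j)"
  have c: "?c differentiable (at x)"
  proof (rule differentiable_det)
    show "(\<lambda>y. (\<chi> i j. if j = k then axis l 1 $ i else G y $ i $ j) $ i $ j) differentiable (at x)" for i j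
      by (cases "j = k") (simp_all add: G)
  qed
  have d: "(\<lambda>y. ?c y / det (G y)) differentiable (at x)"
    by (rule differentiable_divide[OF c differentiable_det[OF G] assms(3)[OF assms(2)]])
  obtain r where r: "r > 0" "ball x r \<subseteq> U"
    using assms(1,2) openE by blast
  show ?thesis
  proof (rule differentiable_transform_within[OF d r(1) UNIV_I])
    fix y assume "dist y x < r"
    then have "y \<in> U" using r(2) by (auto simp: dist_commute)
    then show "?c y / det (G y) = matrix_inv (G y) $ k $ l"
      by (rule matrix_inv_cramer[OF assms(3), symmetric])
  qed
qed

text \<open>Christoffel symbols of the first kind, with the lowered index first; they do not involve
  the inverse metric.\<close>

definition christoffel1 :: "(real^'n::finite \<Rightarrow> real^'n^'n) \<Rightarrow> 'n \<Rightarrow> 'n \<Rightarrow> 'n \<Rightarrow> real^'n \<Rightarrow> real" where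
  "christoffel1 G m j k x = (1/2) * (pd j (\<lambda>y. G y $ k $ m) x + pd k (\<lambda>y. G y $ j $ m) x - pd m (\<lambda>y. G y $ j $ k) x)"

lemma christoffel_eq: "christoffel G l j k x = (\<Sum>m\<in>UNIV. matrix_inv (G x) $ l $ m * christoffel1 G m j k x)"
  by (simp add: christoffel_def christoffel1_def sum_distrib_left mult_ac)

lemma lower_christoffel:
  assumes "det (G x) \<noteq> 0"
  shows "(\<Sum>l\<in>UNIV. G x $ m $ l * christoffel G l j k x) = christoffel1 G m j k x"
proof -
  have "(\<Sum>l\<in>UNIV. G x $ m $ l * christoffel G l j k x)
      = (\<Sum>l\<in>UNIV. \<Sum>n\<in>UNIV. G x $ m $ l * matrix_inv (G x) $ l $ n * christoffel1 G n j k x)"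
    by (simp add: christoffel_eq sum_distrib_left mult_ac)
  also have "\<dots> = (\<Sum>n\<in>UNIV. (G x ** matrix_inv (G x)) $ m $ n * christoffel1 G n j k x)"
    by (subst sum.swap) (simp add: matrix_matrix_mult_def sum_distrib_right)
  also have "\<dots> = christoffel1 G m j k x"
    unfolding invertible_matrix_inv[OF assms] by (simp add: mat_def if_distrib[of "\<lambda>a. a * _"] cong: if_cong)
  finally show ?thesis .
qed

locale smooth_metric =
  fixes G :: "real^'n::finite \<Rightarrow> real^'n^'n" and U :: "(real^'n) set"
  assumes open_U: "open U"
    and smooth_G: "\<And>i j. smooth_on (\<lambda>y. G y $ i $ j) U"
    and sym_G: "\<And>y i j. y \<in> U \<Longrightarrow> G y $ i $ j = G y $ j $ i"
    and det_G: "\<And>y. y \<in> U \<Longrightarrow> det (G y) \<noteq> 0"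
begin

lemma differentiable_christoffel1:
  "x \<in> U \<Longrightarrow> christoffel1 G m j k differentiable (at x)"
  unfolding christoffel1_def [abs_def]
  by (intro differentiable_mult differentiable_diff differentiable_add differentiable_const
      smooth_on_differentiable[OF _ open_U] smooth_on_pd smooth_G)

lemma differentiable_metric: "x \<in> U \<Longrightarrow> (\<lambda>y. G y $ i $ j) differentiable (at x)"
  by (rule smooth_on_differentiable[OF smooth_G open_U])

lemma differentiable_christoffel:
  assumes "x \<in> U"
  shows "christoffel G l j k differentiable (at x)"
proof -
  have "(\<lambda>y. matrix_inv (G y) $ l $ m) differentiable (at x)" for m
    by (rule differentiable_matrix_inv[OF open_U assms]) (simp_all add: det_G differentiable_metric assms)
  moreover have "(\<lambda>y. christoffel1 G m j k y) differentiable (at x)" for m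
    by (rule differentiable_christoffel1[OF assms])
  ultimately have "(\<lambda>y. matrix_inv (G y) $ l $ m * christoffel1 G m j k y) differentiable (at x)" for m
    by (rule differentiable_mult)
  then show ?thesis
    unfolding christoffel_eq [abs_def] by (rule differentiable_sum[OF finite ballI, rotated])
qed

text \<open>This is the compatibility of the Levi-Civita connection with the metric, in
  coordinates.\<close>

lemma pd_metric:
  assumes "x \<in> U"
  shows "pd i (\<lambda>y. G y $ m $ l) x = christoffel1 G l i m x + christoffel1 G m i l x"
proof -
  have "pd a (\<lambda>y. G y $ b $ c) x = pd a (\<lambda>y. G y $ c $ b) x" for a b c
    by (rule pd_cong[OF open_U assms]) (rule sym_G)
  then have "pd i (\<lambda>y. G y $ l $ m) x = pd i (\<lambda>y. G y $ m $ l) x"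
    "pd l (\<lambda>y. G y $ i $ m) x = pd l (\<lambda>y. G y $ m $ i) x"
    "pd m (\<lambda>y. G y $ i $ l) x = pd m (\<lambda>y. G y $ l $ i) x" by blast+
  then show ?thesis
    unfolding christoffel1_def by (simp add: field_simps)
qed

text \<open>The product rule for the lowering identity isolates the derivative of the symbols, and
  no formula for the derivative of the inverse metric is needed.\<close>

lemma lower_pd_christoffel:
  assumes "x \<in> U"
  shows "(\<Sum>l\<in>UNIV. G x $ m $ l * pd i (christoffel G l j k) x) = pd i (christoffel1 G m j k) x
    - (\<Sum>l\<in>UNIV. (christoffel1 G l i m x + christoffel1 G m i l x) * christoffel G l j k x)"
proof -
  have "pd i (christoffel1 G m j k) x = pd i (\<lambda>y. \<Sum>l\<in>UNIV. G y $ m $ l * christoffel G l j k y) x"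
    by (rule pd_cong[OF open_U assms]) (simp add: lower_christoffel det_G)
  also have "\<dots> = (\<Sum>l\<in>UNIV. pd i (\<lambda>y. G y $ m $ l) x * christoffel G l j k x + G x $ m $ l * pd i (christoffel G l j k) x)"
    using differentiable_metric[OF assms] differentiable_christoffel[OF assms]
    by (simp add: pd_sum pd_mult)
  finally show ?thesis
    by (simp add: pd_metric[OF assms] sum.distrib)
qed

text \<open>Lowering the differentiated symbols leaves two corrections. The one with
  \<open>m\<close> in first position cancels the quadratic terms of \<open>riemann\<close>; the
  other becomes the quadratic part here.\<close>

lemma lower_riemann:
  assumes "x \<in> U"
  shows "(\<Sum>l\<in>UNIV. G x $ m $ l * riemann G l i j k x) =
    pd i (christoffel1 G m j k) x - pd j (christoffel1 G m i k) x
    - (\<Sum>l\<in>UNIV. christoffel1 G l i m x * christoffel G l j k x - christoffel1 G l j m x * christoffel G l i k x)"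
proof -
  have quad: "(\<Sum>l\<in>UNIV. G x $ m $ l * (\<Sum>n\<in>UNIV. christoffel G l i n x * christoffel G n j k x))
      = (\<Sum>n\<in>UNIV. christoffel1 G m i n x * christoffel G n j k x)" for i j
  proof -
    have "(\<Sum>l\<in>UNIV. G x $ m $ l * (\<Sum>n\<in>UNIV. christoffel G l i n x * christoffel G n j k x))
      = (\<Sum>n\<in>UNIV. (\<Sum>l\<in>UNIV. G x $ m $ l * christoffel G l i n x) * christoffel G n j k x)"
      unfolding sum_distrib_left sum_distrib_right by (subst sum.swap) (simp add: mult.assoc)
    then show ?thesis
      by (simp add: lower_christoffel[where G = G and x = x, OF det_G[OF assms]])
  qed
  have "(\<Sum>l\<in>UNIV. G x $ m $ l * riemann G l i j k x) =
     (\<Sum>l\<in>UNIV. G x $ m $ l * pd i (christoffel G l j k) x) - (\<Sum>l\<in>UNIV. G x $ m $ l * pd j (christoffel G l i k) x)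
     + ((\<Sum>l\<in>UNIV. G x $ m $ l * (\<Sum>n\<in>UNIV. christoffel G l i n x * christoffel G n j k x))
       - (\<Sum>l\<in>UNIV. G x $ m $ l * (\<Sum>n\<in>UNIV. christoffel G l j n x * christoffel G n i k x)))"
    unfolding riemann_def sum_subtractf
    by (simp add: distrib_left right_diff_distrib sum.distrib sum_subtractf)
  then show ?thesis
    unfolding quad lower_pd_christoffel[OF assms]
    by (simp add: distrib_right sum.distrib sum_subtractf)
qed

end

section \<open>Metrics with totally symmetric first derivatives\<close>

text \<open>The index pairs \<open>i\<close>, \<open>m\<close> and \<open>j\<close>,
  \<open>k\<close> meet only through \<open>l\<close>, so the contraction is a pairing of two
  vectors.\<close>

lemma sum_contract_split:
  fixes a b :: "'l \<Rightarrow> 'n \<Rightarrow> 'n \<Rightarrow> 'a::comm_ring_1"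
  shows "(\<Sum>i\<in>I. \<Sum>j\<in>I. \<Sum>k\<in>I. \<Sum>m\<in>I. (\<Sum>l\<in>L. a l i m * b l j k) * p i * q j * r k * s m)
    = (\<Sum>l\<in>L. (\<Sum>i\<in>I. \<Sum>m\<in>I. a l i m * p i * s m) * (\<Sum>j\<in>I. \<Sum>k\<in>I. b l j k * q j * r k))"
proof -
  let ?t = "\<lambda>i j k m l. a l i m * p i * s m * (b l j k * q j * r k)"
  have "(\<Sum>i\<in>I. \<Sum>j\<in>I. \<Sum>k\<in>I. \<Sum>m\<in>I. (\<Sum>l\<in>L. a l i m * b l j k) * p i * q j * r k * s m)
    = (\<Sum>i\<in>I. \<Sum>j\<in>I. \<Sum>k\<in>I. \<Sum>m\<in>I. \<Sum>l\<in>L. ?t i j k m l)"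
    by (simp add: sum_distrib_left sum_distrib_right mult_ac)
  also have "\<dots> = (\<Sum>i\<in>I. \<Sum>l\<in>L. \<Sum>j\<in>I. \<Sum>k\<in>I. \<Sum>m\<in>I. ?t i j k m l)"
    by (intro sum.cong refl sum_swap_triple[symmetric])
  also have "\<dots> = (\<Sum>l\<in>L. \<Sum>i\<in>I. \<Sum>j\<in>I. \<Sum>k\<in>I. \<Sum>m\<in>I. ?t i j k m l)"
    by (rule sum.swap)
  also have "\<dots> = (\<Sum>l\<in>L. \<Sum>i\<in>I. \<Sum>j\<in>I. \<Sum>m\<in>I. \<Sum>k\<in>I. ?t i j k m l)"
    by (intro sum.cong refl sum.swap)
  also have "\<dots> = (\<Sum>l\<in>L. \<Sum>i\<in>I. \<Sum>m\<in>I. \<Sum>j\<in>I. \<Sum>k\<in>I. ?t i j k m l)"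
    by (intro sum.cong refl sum.swap)
  also have "\<dots> = (\<Sum>l\<in>L. (\<Sum>i\<in>I. \<Sum>m\<in>I. a l i m * p i * s m) * (\<Sum>j\<in>I. \<Sum>k\<in>I. b l j k * q j * r k))"
    unfolding sum_distrib_right unfolding sum_distrib_left ..
  finally show ?thesis .
qed

lemma contract3_inner:
  "contract3 F u v \<bullet> w = (\<Sum>c\<in>UNIV. \<Sum>a\<in>UNIV. \<Sum>b\<in>UNIV. F a b c * u$a * v$b * w$c)"
  by (simp add: contract3_def inner_vec_def sum_distrib_right)

lemma form_inner: "u \<bullet> (M *v v) = (\<Sum>a\<in>UNIV. \<Sum>b\<in>UNIV. M$a$b * u$a * v$b)"
  for M :: "real^'n^'n"
  by (simp add: matrix_vector_mult_def inner_vec_def sum_distrib_left mult_ac)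

definition tangent_pd :: "'m::finite \<Rightarrow> (real^'m \<Rightarrow> real^'n) \<Rightarrow> real^'m \<Rightarrow> real^'n" where
  "tangent_pd i u y = (\<chi> a. pd i (\<lambda>z. u z $ a) y)"

lemma pd_form_inner:
  fixes u v :: "real^'m \<Rightarrow> real^'n"
  assumes [simp]: "\<And>a b. (\<lambda>z. M z $ a $ b) differentiable (at y)"
    "\<And>a. (\<lambda>z. u z $ a) differentiable (at y)" "\<And>a. (\<lambda>z. v z $ a) differentiable (at y)"
  shows "pd i (\<lambda>z. u z \<bullet> (M z *v v z)) y = u y \<bullet> ((\<chi> a b. pd i (\<lambda>z. M z $ a $ b) y) *v v y)
     + tangent_pd i u y \<bullet> (M y *v v y) + u y \<bullet> (M y *v tangent_pd i v y)"
  unfolding form_inner tangent_pd_def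
  by (simp add: pd_sum pd_mult sum.distrib algebra_simps)

lemma pd_contract3_inner:
  fixes u v w :: "real^'m \<Rightarrow> real^'n"
  assumes [simp]: "\<And>a b c. (\<lambda>z. F z a b c) differentiable (at y)"
    "\<And>a. (\<lambda>z. u z $ a) differentiable (at y)" "\<And>a. (\<lambda>z. v z $ a) differentiable (at y)"
    "\<And>a. (\<lambda>z. w z $ a) differentiable (at y)"
  shows "pd i (\<lambda>z. contract3 (F z) (u z) (v z) \<bullet> w z) y =
       contract3 (\<lambda>a b c. pd i (\<lambda>z. F z a b c) y) (u y) (v y) \<bullet> w y
     + contract3 (F y) (tangent_pd i u y) (v y) \<bullet> w y
     + contract3 (F y) (u y) (tangent_pd i v y) \<bullet> w y
     + contract3 (F y) (u y) (v y) \<bullet> tangent_pd i w y"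
  unfolding contract3_inner tangent_pd_def
  by (simp add: pd_sum pd_mult sum.distrib algebra_simps)

text \<open>The Codazzi symmetry is the integrability condition for \<open>G\<close> to be locally
  the Hessian of a potential, expressed without mentioning the potential.\<close>

locale hessian_type_metric = smooth_metric G U
  for G :: "real^'n::finite \<Rightarrow> real^'n^'n" and U +
  assumes codazzi: "\<And>x a b c. x \<in> U \<Longrightarrow> pd a (\<lambda>y. G y $ b $ c) x = pd b (\<lambda>y. G y $ a $ c) x"
begin

definition cubic :: "real^'n \<Rightarrow> 'n \<Rightarrow> 'n \<Rightarrow> 'n \<Rightarrow> real" where
  "cubic x a b c = pd a (\<lambda>y. G y $ b $ c) x"

lemma sym3_cubic:
  assumes "x \<in> U"
  shows "sym3 (cubic x)"
proof -
  have "cubic x a b c = cubic x a c b" for a b c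
    unfolding cubic_def by (rule pd_cong[OF open_U assms]) (rule sym_G)
  then show ?thesis
    unfolding sym3_def using codazzi[OF assms] by (simp add: cubic_def)
qed

lemma smooth_cubic: "smooth_on (\<lambda>x. cubic x a b c) U"
  unfolding cubic_def by (rule smooth_on_pd[OF smooth_G])

text \<open>By total symmetry the three terms of the symbol coincide, two with sign plus and one
  with sign minus.\<close>

lemma christoffel1_cubic:
  assumes "x \<in> U"
  shows "christoffel1 G m j k x = cubic x j k m / 2"
proof -
  have "christoffel1 G m j k x = (1/2) * (cubic x j k m + cubic x k j m - cubic x m j k)"
    by (simp add: christoffel1_def cubic_def)
  also have "\<dots> = cubic x j k m / 2"
  proof -
    have "cubic x k j m = cubic x j k m" "cubic x m j k = cubic x j k m"
      using sym3_swaps[OF sym3_cubic[OF assms]] by metis+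
    then show ?thesis by simp
  qed
  finally show ?thesis by simp
qed

lemma pd_cubic_commute:
  assumes "x \<in> U"
  shows "pd r (\<lambda>x. cubic x a b c) x = pd a (\<lambda>x. cubic x r b c) x"
  using smooth_on_pd_commute[OF open_U smooth_G assms] by (simp add: cubic_def)

lemma riemann_cubic:
  assumes "x \<in> U"
  shows "(\<Sum>l\<in>UNIV. G x $ m $ l * riemann G l i j k x) =
    - (\<Sum>l\<in>UNIV. cubic x i m l / 2 * christoffel G l j k x) + (\<Sum>l\<in>UNIV. cubic x j m l / 2 * christoffel G l i k x)"
proof -
  have *: "pd i (christoffel1 G m j k) x = pd i (\<lambda>x. 1/2 * cubic x j k m) x" for i j k
    by (rule pd_cong[OF open_U assms]) (simp add: christoffel1_cubic)
  \<comment> \<open>Both sides are half of a second derivative of \<open>G\<close> at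
    \<open>k m\<close>, in the directions \<open>i\<close> and \<open>j\<close>; the derivative part
    of the curvature therefore vanishes.\<close>
  have "pd i (christoffel1 G m j k) x = pd j (christoffel1 G m i k) x"
    unfolding *
    using smooth_on_differentiable[OF smooth_cubic open_U assms]
    by (simp add: pd_cmult pd_cubic_commute[OF assms, of i j k m] del: times_divide_eq_left)
  then show ?thesis
    unfolding lower_riemann[OF assms] christoffel1_cubic[OF assms] by (simp add: sum_subtractf)
qed

lemma christoffel_contract:
  assumes "x \<in> U"
  shows "(\<Sum>j\<in>UNIV. \<Sum>k\<in>UNIV. christoffel G l j k x * q$j * r$k) = (1/2) * (matrix_inv (G x) *v contract3 (cubic x) q r) $ l"
proof -
  have "(\<Sum>j\<in>UNIV. \<Sum>k\<in>UNIV. christoffel G l j k x * q$j * r$k) =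
      (\<Sum>j\<in>UNIV. \<Sum>k\<in>UNIV. \<Sum>n\<in>UNIV. (1/2) * matrix_inv (G x) $ l $ n * cubic x j k n * q$j * r$k)"
    unfolding christoffel_eq christoffel1_cubic[OF assms] by (simp add: sum_distrib_left sum_distrib_right mult_ac)
  also have "\<dots> = (\<Sum>j\<in>UNIV. \<Sum>n\<in>UNIV. \<Sum>k\<in>UNIV. (1/2) * matrix_inv (G x) $ l $ n * cubic x j k n * q$j * r$k)"
    by (intro sum.cong refl sum.swap)
  also have "\<dots> = (\<Sum>n\<in>UNIV. \<Sum>j\<in>UNIV. \<Sum>k\<in>UNIV. (1/2) * matrix_inv (G x) $ l $ n * cubic x j k n * q$j * r$k)"
    by (rule sum.swap)
  also have "\<dots> = (1/2) * (matrix_inv (G x) *v contract3 (cubic x) q r) $ l"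
    by (simp add: matrix_vector_mult_def contract3_def sum_distrib_left mult_ac)
  finally show ?thesis .
qed

lemma riem4_cubic:
  assumes "x \<in> U"
  shows "riem4 G x v w w v = - (1/4) *
     (contract3 (cubic x) v v \<bullet> (matrix_inv (G x) *v contract3 (cubic x) w w)
      - contract3 (cubic x) v w \<bullet> (matrix_inv (G x) *v contract3 (cubic x) v w))"
proof -
  have half: "(\<Sum>j\<in>UNIV. \<Sum>m\<in>UNIV. cubic x j m l / 2 * p$j * q$m) = (1/2) * contract3 (cubic x) p q $ l" for p q l
    by (simp add: contract3_def sum_divide_distrib)
  have "riem4 G x v w w v = (\<Sum>i\<in>UNIV. \<Sum>j\<in>UNIV. \<Sum>k\<in>UNIV. \<Sum>m\<in>UNIV. \<Sum>l\<in>UNIV.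
      riemann G l i j k x * v $ i * w $ j * w $ k * G x $ l $ m * v $ m)"
    unfolding riem4_def by (intro sum.cong refl sum.swap)
  also have "\<dots> = (\<Sum>i\<in>UNIV. \<Sum>j\<in>UNIV. \<Sum>k\<in>UNIV. \<Sum>m\<in>UNIV.
      (\<Sum>l\<in>UNIV. G x $ m $ l * riemann G l i j k x) * v $ i * w $ j * w $ k * v $ m)"
    unfolding sum_distrib_right by (intro sum.cong refl) (subst sym_G[OF assms], simp only: mult_ac)
  also have "\<dots> = - (\<Sum>i\<in>UNIV. \<Sum>j\<in>UNIV. \<Sum>k\<in>UNIV. \<Sum>m\<in>UNIV.
      (\<Sum>l\<in>UNIV. cubic x i m l / 2 * christoffel G l j k x) * v $ i * w $ j * w $ k * v $ m)
    + (\<Sum>i\<in>UNIV. \<Sum>j\<in>UNIV. \<Sum>k\<in>UNIV. \<Sum>m\<in>UNIV.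
      (\<Sum>l\<in>UNIV. cubic x j m l / 2 * christoffel G l i k x) * v $ i * w $ j * w $ k * v $ m)"
    unfolding riemann_cubic[OF assms] by (simp add: left_diff_distrib sum_subtractf)
  \<comment> \<open>Exchanging the sums over \<open>i\<close> and \<open>j\<close> gives this half
    the index pattern of the other one, with the first two arguments interchanged.\<close>
  also have "(\<Sum>i\<in>UNIV. \<Sum>j\<in>UNIV. \<Sum>k\<in>UNIV. \<Sum>m\<in>UNIV.
      (\<Sum>l\<in>UNIV. cubic x j m l / 2 * christoffel G l i k x) * v $ i * w $ j * w $ k * v $ m)
     = (\<Sum>j\<in>UNIV. \<Sum>i\<in>UNIV. \<Sum>k\<in>UNIV. \<Sum>m\<in>UNIV.
      (\<Sum>l\<in>UNIV. cubic x j m l / 2 * christoffel G l i k x) * w $ j * v $ i * w $ k * v $ m)"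
    by (subst sum.swap) (simp only: mult_ac)
  also have "\<dots> = (1/4) * (contract3 (cubic x) w v \<bullet> (matrix_inv (G x) *v contract3 (cubic x) v w))"
    unfolding sum_contract_split[where a = "\<lambda>l j m. cubic x j m l / 2"] christoffel_contract[OF assms] half
    by (simp add: inner_vec_def sum_divide_distrib)
  also have "(\<Sum>i\<in>UNIV. \<Sum>j\<in>UNIV. \<Sum>k\<in>UNIV. \<Sum>m\<in>UNIV.
      (\<Sum>l\<in>UNIV. cubic x i m l / 2 * christoffel G l j k x) * v $ i * w $ j * w $ k * v $ m)
     = (1/4) * (contract3 (cubic x) v v \<bullet> (matrix_inv (G x) *v contract3 (cubic x) w w))"
    unfolding sum_contract_split[where a = "\<lambda>l j m. cubic x j m l / 2"] christoffel_contract[OF assms] half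
    by (simp add: inner_vec_def sum_divide_distrib)
  finally show ?thesis
    unfolding contract3_swap(1)[OF sym3_cubic[OF assms], of w v] by (simp add: field_simps)
qed

end

text \<open>Meant for covectors of the form \<open>acceleration\<close>: \<open>c\<close> is a
  contraction of the cubic form and \<open>s\<close> a second derivative of the parametrisation. The
  last three terms are those that occur in \<open>christoffel1_induced_alternation\<close>.\<close>

lemma half_sum_inverse_form:
  fixes M :: "real^'n^'n"
  assumes "transpose M = M" "det M \<noteq> 0"
  shows "((1/2) *\<^sub>R c + M *v s) \<bullet> (matrix_inv M *v ((1/2) *\<^sub>R c' + M *v s')) =
     1/4 * (c \<bullet> (matrix_inv M *v c')) + 1/2 * (c \<bullet> s') + 1/2 * (c' \<bullet> s) + s \<bullet> (M *v s')"
proof -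
  have inv: "matrix_inv M *v (M *v z) = z" "M *v (matrix_inv M *v z) = z" for z
    by (simp_all add: matrix_vector_mul_assoc invertible_matrix_inv[OF assms(2)])
  have "(M *v s) \<bullet> z = s \<bullet> (M *v z)" for z
    using symmetric_form_swap[OF assms(1), of z s] by (simp add: inner_commute)
  then show ?thesis
    by (simp add: matrix_vector_right_distrib matrix_vector_mult_scaleR inner_left_distrib inner_right_distrib
      inv inner_commute[of s c'])
qed

text \<open>With \<open>Q\<close> the derivative of the cubic form, the direction of differentiation
  can be exchanged with an argument of the form.\<close>

lemma contract3_symmetric_slot:
  assumes "\<And>r a b c. Q r a b c = Q a r b c"
  shows "contract3 (\<lambda>a b c. \<Sum>r\<in>UNIV. Q r a b c * p $ r) q u \<bullet> v
    = contract3 (\<lambda>a b c. \<Sum>r\<in>UNIV. Q r a b c * q $ r) p u \<bullet> v"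
proof -
  have "(\<Sum>a\<in>UNIV. \<Sum>b\<in>UNIV. (\<Sum>r\<in>UNIV. Q r a b c * p$r) * q$a * u$b * v$c) =
     (\<Sum>a\<in>UNIV. \<Sum>b\<in>UNIV. (\<Sum>r\<in>UNIV. Q r a b c * q$r) * p$a * u$b * v$c)" for c
  proof -
    have "(\<Sum>a\<in>UNIV. \<Sum>b\<in>UNIV. (\<Sum>r\<in>UNIV. Q r a b c * p$r) * q$a * u$b * v$c) =
      (\<Sum>a\<in>UNIV. \<Sum>b\<in>UNIV. \<Sum>r\<in>UNIV. Q r a b c * p$r * q$a * u$b * v$c)"
      by (simp only: sum_distrib_right)
    also have "\<dots> = (\<Sum>a\<in>UNIV. \<Sum>r\<in>UNIV. \<Sum>b\<in>UNIV. Q r a b c * p$r * q$a * u$b * v$c)"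
      by (intro sum.cong refl sum.swap)
    also have "\<dots> = (\<Sum>r\<in>UNIV. \<Sum>a\<in>UNIV. \<Sum>b\<in>UNIV. Q r a b c * p$r * q$a * u$b * v$c)"
      by (rule sum.swap)
    also have "\<dots> = (\<Sum>r\<in>UNIV. \<Sum>b\<in>UNIV. \<Sum>a\<in>UNIV. Q r a b c * p$r * q$a * u$b * v$c)"
      by (intro sum.cong refl sum.swap)
    also have "\<dots> = (\<Sum>r\<in>UNIV. \<Sum>b\<in>UNIV. \<Sum>a\<in>UNIV. Q a r b c * q$a * p$r * u$b * v$c)"
      by (intro sum.cong refl) (subst assms, simp only: mult_ac)
    also have "\<dots> = (\<Sum>a\<in>UNIV. \<Sum>b\<in>UNIV. (\<Sum>r\<in>UNIV. Q r a b c * q$r) * p$a * u$b * v$c)"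
      by (simp only: sum_distrib_right)
    finally show ?thesis .
  qed
  then show ?thesis by (simp add: contract3_inner)
qed

section \<open>The form induced along a smooth map\<close>

locale hessian_type_pullback = hessian_type_metric G U
  for G :: "real^'n::finite \<Rightarrow> real^'n^'n" and U +
  fixes \<phi> :: "real^'m::finite \<Rightarrow> real^'n" and V :: "(real^'m) set"
  assumes open_V: "open V" and image_V: "\<phi> ` V \<subseteq> U" and smooth_\<phi>: "\<And>i. smooth_on (\<lambda>y. \<phi> y $ i) V"
begin

definition tangent :: "'m \<Rightarrow> real^'m \<Rightarrow> real^'n" where
  "tangent a = tangent_pd a \<phi>"

definition second :: "'m \<Rightarrow> 'm \<Rightarrow> real^'m \<Rightarrow> real^'n" where
  "second a b = tangent_pd a (tangent b)"

text \<open>Nothing makes this form nondegenerate at this stage, so only symbols of the first kind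
  are computed for it here.\<close>

definition induced :: "real^'m \<Rightarrow> real^'m^'m" where
  "induced y = (\<chi> a b. tangent a y \<bullet> (G (\<phi> y) *v tangent b y))"

lemma mem_U: "y \<in> V \<Longrightarrow> \<phi> y \<in> U"
  using image_V by blast

lemma smooth_tangent: "smooth_on (\<lambda>y. tangent a y $ i) V"
  unfolding tangent_def tangent_pd_def by (simp add: smooth_on_pd smooth_\<phi>)

lemma smooth_second: "smooth_on (\<lambda>y. second a b y $ i) V"
  unfolding second_def tangent_pd_def by (simp add: smooth_on_pd smooth_tangent)

lemma smooth_pulled_metric: "smooth_on (\<lambda>y. G (\<phi> y) $ i $ j) V"
  by (rule smooth_on_compose[OF open_U open_V image_V smooth_G smooth_\<phi>])

lemma smooth_pulled_cubic: "smooth_on (\<lambda>y. cubic (\<phi> y) i j k) V"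
  by (rule smooth_on_compose[OF open_U open_V image_V smooth_cubic smooth_\<phi>])

lemmas differentiable_pulled =
  smooth_on_differentiable[OF smooth_tangent open_V]
  smooth_on_differentiable[OF smooth_second open_V]
  smooth_on_differentiable[OF smooth_pulled_metric open_V]
  smooth_on_differentiable[OF smooth_pulled_cubic open_V]

lemma second_commute: "y \<in> V \<Longrightarrow> second a b y = second b a y"
  unfolding second_def tangent_def tangent_pd_def vec_eq_iff
  by (simp add: smooth_on_pd_commute[OF open_V smooth_\<phi>])

lemma third_commute:
  assumes "y \<in> V"
  shows "tangent_pd i (second j k) y = tangent_pd j (second i k) y"
  using smooth_on_pd_commute[OF open_V smooth_tangent assms]
  unfolding second_def tangent_pd_def vec_eq_iff by simp

lemma smooth_induced: "smooth_on (\<lambda>y. induced y $ a $ b) V"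
  unfolding induced_def form_inner
  by (simp add: smooth_on_sum smooth_on_mult smooth_tangent smooth_pulled_metric open_V)

lemma pulled_metric_form_swap:
  "y \<in> V \<Longrightarrow> u \<bullet> (G (\<phi> y) *v v) = v \<bullet> (G (\<phi> y) *v u)"
  by (rule symmetric_form_swap) (simp add: transpose_def vec_eq_iff sym_G[OF mem_U])

lemma pd_pulled_metric:
  assumes "y \<in> V"
  shows "u \<bullet> ((\<chi> a b. pd i (\<lambda>z. G (\<phi> z) $ a $ b) y) *v v) = contract3 (cubic (\<phi> y)) (tangent i y) u \<bullet> v"
proof -
  have *: "pd i (\<lambda>z. G (\<phi> z) $ a $ b) y = (\<Sum>r\<in>UNIV. cubic (\<phi> y) r a b * tangent i y $ r)" for a b
    unfolding cubic_def tangent_def tangent_pd_def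
    using pd_compose[of "\<lambda>x. G x $ a $ b" \<phi> y i, OF differentiable_metric[OF mem_U[OF assms]]
      smooth_on_differentiable[OF smooth_\<phi> open_V assms]] by simp
  have "u \<bullet> ((\<chi> a b. pd i (\<lambda>z. G (\<phi> z) $ a $ b) y) *v v)
     = (\<Sum>a\<in>UNIV. \<Sum>b\<in>UNIV. \<Sum>r\<in>UNIV. cubic (\<phi> y) r a b * tangent i y $ r * u $ a * v $ b)"
    unfolding form_inner by (simp add: * sum_distrib_right)
  also have "\<dots> = (\<Sum>b\<in>UNIV. \<Sum>a\<in>UNIV. \<Sum>r\<in>UNIV. cubic (\<phi> y) r a b * tangent i y $ r * u $ a * v $ b)"
    by (rule sum.swap)
  also have "\<dots> = (\<Sum>b\<in>UNIV. \<Sum>r\<in>UNIV. \<Sum>a\<in>UNIV. cubic (\<phi> y) r a b * tangent i y $ r * u $ a * v $ b)"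
    by (intro sum.cong refl sum.swap)
  finally show ?thesis unfolding contract3_inner .
qed

lemma pd_induced:
  assumes "y \<in> V"
  shows "pd i (\<lambda>z. induced z $ a $ b) y = contract3 (cubic (\<phi> y)) (tangent i y) (tangent a y) \<bullet> tangent b y
     + second i a y \<bullet> (G (\<phi> y) *v tangent b y) + second i b y \<bullet> (G (\<phi> y) *v tangent a y)"
  unfolding induced_def using differentiable_pulled[OF assms]
  by (simp add: pd_form_inner pd_pulled_metric[OF assms] second_def
      pulled_metric_form_swap[OF assms, of "tangent a y"])

lemma contract3_cubic_swap:
  assumes "y \<in> V"
  shows "contract3 (cubic (\<phi> y)) u v = contract3 (cubic (\<phi> y)) v u"
    "contract3 (cubic (\<phi> y)) u v \<bullet> w = contract3 (cubic (\<phi> y)) u w \<bullet> v"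
  using contract3_swap[OF sym3_cubic[OF mem_U[OF assms]]] by blast+

text \<open>Of the six products of a second derivative with a tangent vector four cancel and two
  agree; the cubic terms occur with signs plus, plus, minus.\<close>

lemma christoffel1_induced:
  assumes "y \<in> V"
  shows "christoffel1 induced m j k y =
    1/2 * (contract3 (cubic (\<phi> y)) (tangent j y) (tangent k y) \<bullet> tangent m y)
     + second j k y \<bullet> (G (\<phi> y) *v tangent m y)"
  unfolding christoffel1_def pd_induced[OF assms]
  using second_commute[OF assms, of j k] second_commute[OF assms, of j m] second_commute[OF assms, of k m]
    contract3_cubic_swap(1)[OF assms, of "tangent k y" "tangent j y"]
    contract3_cubic_swap(1)[OF assms, of "tangent m y" "tangent j y"]
    contract3_cubic_swap(2)[OF assms, of "tangent j y" "tangent m y" "tangent k y"]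
  by (simp add: field_simps)

lemma pd_christoffel1_induced:
  assumes "y \<in> V"
  shows "pd i (christoffel1 induced m j k) y =
    1/2 * (contract3 (\<lambda>a b c. \<Sum>r\<in>UNIV. pd r (\<lambda>x. cubic x a b c) (\<phi> y) * tangent i y $ r) (tangent j y) (tangent k y) \<bullet> tangent m y
       + contract3 (cubic (\<phi> y)) (second i j y) (tangent k y) \<bullet> tangent m y
       + contract3 (cubic (\<phi> y)) (tangent j y) (second i k y) \<bullet> tangent m y
       + contract3 (cubic (\<phi> y)) (tangent j y) (tangent k y) \<bullet> second i m y)
    + tangent_pd i (second j k) y \<bullet> (G (\<phi> y) *v tangent m y)
    + contract3 (cubic (\<phi> y)) (tangent i y) (second j k y) \<bullet> tangent m y
    + second j k y \<bullet> (G (\<phi> y) *v second i m y)"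
proof -
  note diff = differentiable_pulled[OF assms]
  have chain: "pd i (\<lambda>z. cubic (\<phi> z) a b c) y = (\<Sum>r\<in>UNIV. pd r (\<lambda>x. cubic x a b c) (\<phi> y) * tangent i y $ r)" for a b c
    using pd_compose[of "\<lambda>x. cubic x a b c" \<phi> y i, OF smooth_on_differentiable[OF smooth_cubic open_U mem_U[OF assms]]
      smooth_on_differentiable[OF smooth_\<phi> open_V assms]]
    by (simp add: tangent_def tangent_pd_def)
  have "pd i (christoffel1 induced m j k) y = pd i (\<lambda>y. 1/2 * (contract3 (cubic (\<phi> y)) (tangent j y) (tangent k y) \<bullet> tangent m y)
     + second j k y \<bullet> (G (\<phi> y) *v tangent m y)) y"
    by (rule pd_cong[OF open_V assms christoffel1_induced])
  also have "\<dots> = 1/2 * pd i (\<lambda>y. contract3 (cubic (\<phi> y)) (tangent j y) (tangent k y) \<bullet> tangent m y) y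
    + pd i (\<lambda>y. second j k y \<bullet> (G (\<phi> y) *v tangent m y)) y"
  proof -
    have d1: "(\<lambda>y. contract3 (cubic (\<phi> y)) (tangent j y) (tangent k y) \<bullet> tangent m y) differentiable (at y)"
      unfolding contract3_inner by (simp add: diff)
    have d2: "(\<lambda>y. second j k y \<bullet> (G (\<phi> y) *v tangent m y)) differentiable (at y)"
      unfolding form_inner by (simp add: diff)
    have d3: "(\<lambda>y. 1/2 * (contract3 (cubic (\<phi> y)) (tangent j y) (tangent k y) \<bullet> tangent m y)) differentiable (at y)"
      by (rule differentiable_mult[OF differentiable_const d1])
    show ?thesis
      unfolding pd_add[OF d3 d2] pd_cmult[OF d1] ..
  qed
  also have "\<dots> = 1/2 * (contract3 (\<lambda>a b c. \<Sum>r\<in>UNIV. pd r (\<lambda>x. cubic x a b c) (\<phi> y) * tangent i y $ r) (tangent j y) (tangent k y) \<bullet> tangent m y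
       + contract3 (cubic (\<phi> y)) (second i j y) (tangent k y) \<bullet> tangent m y
       + contract3 (cubic (\<phi> y)) (tangent j y) (second i k y) \<bullet> tangent m y
       + contract3 (cubic (\<phi> y)) (tangent j y) (tangent k y) \<bullet> second i m y)
    + (contract3 (cubic (\<phi> y)) (tangent i y) (second j k y) \<bullet> tangent m y
       + tangent_pd i (second j k) y \<bullet> (G (\<phi> y) *v tangent m y)
       + second j k y \<bullet> (G (\<phi> y) *v second i m y))"
    by (subst pd_contract3_inner, (rule diff)+, subst pd_form_inner, (rule diff)+)
       (simp only: pd_pulled_metric[OF assms] chain second_def[of i, symmetric])
  finally show ?thesis by simp
qed

text \<open>Symmetric in \<open>i\<close> and \<open>j\<close>, and hence gone, are the derivative
  of the cubic form, the third derivatives of \<open>\<phi>\<close> and the terms with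
  \<open>second i j\<close>. A cubic term with coefficient 1 from differentiating the metric meets
  one with 1/2 from the other summand, leaving 1/2.\<close>

lemma christoffel1_induced_alternation:
  assumes "y \<in> V"
  defines "C \<equiv> contract3 (cubic (\<phi> y))"
  shows "pd i (christoffel1 induced m j k) y - pd j (christoffel1 induced m i k) y =
     (1/2 * (C (tangent j y) (tangent k y) \<bullet> second i m y) + 1/2 * (C (tangent i y) (tangent m y) \<bullet> second j k y)
       + second j k y \<bullet> (G (\<phi> y) *v second i m y))
   - (1/2 * (C (tangent i y) (tangent k y) \<bullet> second j m y) + 1/2 * (C (tangent j y) (tangent m y) \<bullet> second i k y)
       + second i k y \<bullet> (G (\<phi> y) *v second j m y))"
proof -
  have "contract3 (\<lambda>a b c. \<Sum>r\<in>UNIV. pd r (\<lambda>x. cubic x a b c) (\<phi> y) * tangent i y $ r) (tangent j y) (tangent k y) \<bullet> tangent m y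
    = contract3 (\<lambda>a b c. \<Sum>r\<in>UNIV. pd r (\<lambda>x. cubic x a b c) (\<phi> y) * tangent j y $ r) (tangent i y) (tangent k y) \<bullet> tangent m y"
    by (rule contract3_symmetric_slot) (rule pd_cubic_commute[OF mem_U[OF assms(1)]])
  then show ?thesis
    unfolding pd_christoffel1_induced[OF assms(1)] C_def third_commute[OF assms(1), of i j k] second_commute[OF assms(1), of i j]
    using contract3_cubic_swap(2)[OF assms(1), of "tangent i y" "tangent m y" "second j k y"]
      contract3_cubic_swap(2)[OF assms(1), of "tangent j y" "tangent m y" "second i k y"]
    by (simp add: field_simps)
qed

end

section \<open>Hessian metrics of homogeneous functions\<close>

lemma euler_pd:
  assumes "open U" "smooth_on g U" and g: "\<And>x. x \<in> U \<Longrightarrow> (\<Sum>i\<in>UNIV. pd i g x * x $ i) = c * g x"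
    and "x \<in> U"
  shows "(\<Sum>i\<in>UNIV. pd i (pd j g) x * x $ i) = (c - 1) * pd j g x"
proof -
  have coord: "(\<lambda>x. x $ i) differentiable (at x)" for i
    by (rule bounded_linear_imp_differentiable[OF bounded_linear_vec_nth])
  have diff: "pd i g differentiable (at x)" for i
    by (rule smooth_on_differentiable[OF smooth_on_pd[OF assms(2)] assms(1,4)])
  have "c * pd j g x = pd j (\<lambda>x. c * g x) x"
    by (rule pd_cmult[symmetric, OF smooth_on_differentiable[OF assms(2,1,4)]])
  also have "\<dots> = pd j (\<lambda>x. \<Sum>i\<in>UNIV. pd i g x * x $ i) x"
    by (rule pd_cong[OF assms(1,4)]) (simp add: g)
  also have "\<dots> = (\<Sum>i\<in>UNIV. pd j (pd i g) x * x $ i + pd i g x * (if i = j then 1 else 0))"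
    using diff coord by (simp add: pd_sum pd_mult pd_coord)
  also have "\<dots> = (\<Sum>i\<in>UNIV. pd i (pd j g) x * x $ i) + pd j g x"
    by (simp add: sum.distrib smooth_on_pd_commute[OF assms(1,2,4), of j] if_distrib[of "\<lambda>r. _ * r"] cong: if_cong)
  finally show ?thesis by (simp add: algebra_simps)
qed

text \<open>The derivative of \<open>g\<close> along the ray is computed at \<open>t = 1\<close> in
  two ways. The scaling law holds for those \<open>t\<close> that keep the ray in \<open>U\<close>;
  they form an open set around 1.\<close>

lemma euler_homogeneous:
  fixes g :: "real^'n \<Rightarrow> real"
  assumes "open U" "smooth_on g U" "x \<in> U"
    and hom: "\<And>t. t > 0 \<Longrightarrow> t *\<^sub>R x \<in> U \<Longrightarrow> g (t *\<^sub>R x) = t powr d * g x"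
  shows "(\<Sum>i\<in>UNIV. pd i g x * x $ i) = d * g x"
proof -
  let ?S = "{t. t > 0 \<and> t *\<^sub>R x \<in> U}"
  have "open {t. t *\<^sub>R x \<in> U}"
    using open_vimage[OF assms(1), of "\<lambda>t. t *\<^sub>R x"] by (simp add: vimage_def continuous_on_scaleR)
  then have S: "open ?S"
    using open_Collect_conj[of "\<lambda>t::real. t > 0" "\<lambda>t. t *\<^sub>R x \<in> U"] open_greaterThan[of "0::real"] by (simp add: greaterThan_def)
  have "(g has_derivative (\<lambda>h. \<Sum>i\<in>UNIV. pd i g x * h $ i)) (at (1 *\<^sub>R x))"
    using frechet_pd[OF smooth_on_differentiable[OF assms(2,1,3)]] by simp
  then have "((\<lambda>t. g (t *\<^sub>R x)) has_derivative (\<lambda>h. \<Sum>i\<in>UNIV. pd i g x * (h *\<^sub>R x) $ i)) (at 1)"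
    by (intro has_derivative_compose[where f = "\<lambda>t. t *\<^sub>R x" and g = g]) (auto intro!: derivative_eq_intros)
  moreover have "(\<lambda>h. \<Sum>i\<in>UNIV. pd i g x * (h *\<^sub>R x) $ i) = (*) (\<Sum>i\<in>UNIV. pd i g x * x $ i)"
    by (rule ext) (simp add: sum_distrib_left sum_distrib_right mult_ac)
  ultimately have "((\<lambda>t. g (t *\<^sub>R x)) has_field_derivative (\<Sum>i\<in>UNIV. pd i g x * x $ i)) (at 1)"
    by (simp add: has_field_derivative_def)
  moreover have "((\<lambda>t. g (t *\<^sub>R x)) has_field_derivative d * g x) (at 1)"
  proof (rule has_field_derivative_transform_within_open[OF _ S])
    show "((\<lambda>t. t powr d * g x) has_field_derivative d * g x) (at 1)"
      by (auto intro!: derivative_eq_intros)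
  qed (use assms(3) hom in auto)
  ultimately show ?thesis by (rule DERIV_unique)
qed

lemma span_eq_hyperplane:
  fixes a b g :: "real^3"
  assumes "independent {a, b}" "a \<noteq> b" "g \<noteq> 0" "g \<bullet> a = 0" "g \<bullet> b = 0"
  shows "span {a, b} = {u. g \<bullet> u = 0}"
proof (rule subspace_dim_equal)
  show "span {a, b} \<subseteq> {u. g \<bullet> u = 0}"
    using assms(4,5) by (intro span_minimal subspace_hyperplane) auto
  have "dim (span {a, b}) = 2"
    using assms(1,2) by (simp add: dim_eq_card_independent)
  then show "dim {u. g \<bullet> u = 0} \<le> dim (span {a, b})"
    using dim_hyperplane[OF assms(3)] by simp
qed (simp_all add: subspace_hyperplane)

text \<open>Written in the shape of the tangential part of
  \<open>inverse_form_orthogonal_frame\<close>, with which it is later matched term by term.\<close>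

lemma inverse_form_2:
  fixes M :: "real^2^2"
  assumes "det M \<noteq> 0" "M $ 2 $ 1 = M $ 1 $ 2"
  shows "(\<Sum>l\<in>UNIV. a l * (\<Sum>m\<in>UNIV. matrix_inv M $ l $ m * b m)) =
     (a 1 * b 1 * M $ 2 $ 2 - (a 1 * b 2 + a 2 * b 1) * M $ 1 $ 2 + a 2 * b 2 * M $ 1 $ 1) / (M $ 1 $ 1 * M $ 2 $ 2 - (M $ 1 $ 2)\<^sup>2)"
proof -
  have "det M = M $ 1 $ 1 * M $ 2 $ 2 - (M $ 1 $ 2)\<^sup>2"
    by (simp add: det_2 assms(2) power2_eq_square)
  then have "matrix_inv M $ 1 $ 1 = M $ 2 $ 2 / (M $ 1 $ 1 * M $ 2 $ 2 - (M $ 1 $ 2)\<^sup>2)"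
    "matrix_inv M $ 1 $ 2 = - M $ 1 $ 2 / (M $ 1 $ 1 * M $ 2 $ 2 - (M $ 1 $ 2)\<^sup>2)"
    "matrix_inv M $ 2 $ 1 = - M $ 1 $ 2 / (M $ 1 $ 1 * M $ 2 $ 2 - (M $ 1 $ 2)\<^sup>2)"
    "matrix_inv M $ 2 $ 2 = M $ 1 $ 1 / (M $ 1 $ 1 * M $ 2 $ 2 - (M $ 1 $ 2)\<^sup>2)"
    unfolding matrix_inv_cramer[OF assms(1)] by (simp_all add: det_2 axis_def assms(2))
  then show ?thesis
    by (simp add: sum_2 algebra_simps add_divide_distrib diff_divide_distrib)
qed

lemma metric_ip_eq_inner: "metric_ip G x v w = v \<bullet> (G x *v w)"
  by (simp add: metric_ip_def form_inner)

lemma clebsch_form_cmult: "clebsch_form (\<lambda>a b c. k * F a b c) = k ^ 4 * clebsch_form F"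
  unfolding clebsch_form_def Let_def by algebra

lemma clebsch_S_eq_form: "clebsch_S f x = clebsch_form (\<lambda>i j k. f3 f i j k x)"
  by (simp add: clebsch_S_def clebsch_form_def)

locale homogeneous_function =
  fixes f :: "real^3 \<Rightarrow> real" and U :: "(real^3) set" and d :: real
  assumes open_dom: "open U" and smooth: "smooth_on f U" and degree: "d > 2"
    and homogeneous: "\<And>x t. x \<in> U \<Longrightarrow> t > 0 \<Longrightarrow> t *\<^sub>R x \<in> U \<Longrightarrow> f (t *\<^sub>R x) = t powr d * f x"
    and nondegenerate: "\<And>x. x \<in> U \<Longrightarrow> hessdet f x \<noteq> 0"
begin

definition \<kappa> :: real where "\<kappa> = - 1 / (d * (d - 1))"

abbreviation g :: "real^3 \<Rightarrow> real^3^3" where "g \<equiv> hess_metric d f"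

lemma \<kappa>_nonzero: "\<kappa> \<noteq> 0"
  using degree by (simp add: \<kappa>_def)

lemma metric_entry: "g x $ i $ j = \<kappa> * pd i (pd j f) x"
  by (simp add: hess_metric_def hessian_def \<kappa>_def)

lemma det_metric: "det (g x) = \<kappa> ^ 3 * hessdet f x"
  unfolding det_3 metric_entry hessdet_def hessian_def by (simp add: algebra_simps power3_eq_cube)

lemma pd_metric_entry:
  assumes "x \<in> U"
  shows "pd a (\<lambda>y. g y $ b $ c) x = \<kappa> * f3 f a b c x"
  unfolding metric_entry f3_def
  by (rule pd_cmult[OF smooth_on_differentiable[OF smooth_on_pd[OF smooth_on_pd[OF smooth]] open_dom assms]])

sublocale hessian_type_metric g U
proof
  show "open U" by (rule open_dom)
  show "smooth_on (\<lambda>y. g y $ i $ j) U" for i j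
    unfolding metric_entry by (intro smooth_on_mult smooth_on_const smooth_on_pd smooth open_dom)
  show "g y $ i $ j = g y $ j $ i" if "y \<in> U" for y i j
    unfolding metric_entry by (simp add: smooth_on_pd_commute[OF open_dom smooth that, of i j])
  show "det (g y) \<noteq> 0" if "y \<in> U" for y
    using \<kappa>_nonzero nondegenerate[OF that] by (simp add: det_metric)
  show "pd a (\<lambda>y. g y $ b $ c) x = pd b (\<lambda>y. g y $ a $ c) x" if "x \<in> U" for x a b c
    unfolding pd_metric_entry[OF that] f3_def
    by (simp add: smooth_on_pd_commute[OF open_dom smooth_on_pd[OF smooth] that, of a b])
qed

lemma euler1: "x \<in> U \<Longrightarrow> (\<Sum>i\<in>UNIV. pd i f x * x $ i) = d * f x"
  by (rule euler_homogeneous[OF open_dom smooth]) (simp_all add: homogeneous)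

lemma euler2: "x \<in> U \<Longrightarrow> (\<Sum>i\<in>UNIV. pd i (pd j f) x * x $ i) = (d - 1) * pd j f x"
  by (rule euler_pd[OF open_dom smooth]) (simp_all add: euler1)

lemma euler3: "x \<in> U \<Longrightarrow> (\<Sum>i\<in>UNIV. f3 f i j k x * x $ i) = (d - 2) * pd j (pd k f) x"
  unfolding f3_def
  using euler_pd[OF open_dom smooth_on_pd[OF smooth], of k "d - 1" x j] by (simp add: euler2)

lemma gradient_inner_position: "x \<in> U \<Longrightarrow> gradient f x \<bullet> x = d * f x"
  by (simp add: gradient_def inner_vec_def euler1)

lemma position_metric:
  assumes "x \<in> U"
  shows "x \<bullet> (g x *v u) = \<kappa> * (d - 1) * (gradient f x \<bullet> u)"
proof -
  have "x \<bullet> (g x *v u) = (\<Sum>b\<in>UNIV. \<Sum>a\<in>UNIV. \<kappa> * pd a (pd b f) x * x $ a * u $ b)"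
    unfolding form_inner metric_entry by (rule sum.swap)
  also have "\<dots> = (\<Sum>b\<in>UNIV. \<kappa> * (\<Sum>a\<in>UNIV. pd a (pd b f) x * x $ a) * u $ b)"
    by (simp add: sum_distrib_left sum_distrib_right mult_ac)
  also have "\<dots> = \<kappa> * (d - 1) * (gradient f x \<bullet> u)"
    unfolding euler2[OF assms] by (simp add: gradient_def inner_vec_def sum_distrib_left mult_ac)
  finally show ?thesis .
qed

text \<open>The normalisation of the metric enters here through
  \<open>\<kappa> * (d - 1) * d = -1\<close>.\<close>

lemma position_norm:
  assumes "x \<in> U"
  shows "x \<bullet> (g x *v x) = - f x"
  unfolding position_metric[OF assms] gradient_inner_position[OF assms]
  using degree by (simp add: \<kappa>_def)

lemma cubic_eq: "x \<in> U \<Longrightarrow> cubic x = (\<lambda>a b c. \<kappa> * f3 f a b c x)"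
  by (intro ext) (simp add: cubic_def pd_metric_entry)

text \<open>Symmetry moves the position vector into the differentiation slot, where Euler's identity
  applies to the second derivatives, homogeneous of degree \<open>d - 2\<close>.\<close>

lemma cubic_position:
  assumes "x \<in> U"
  shows "contract3 (cubic x) u v \<bullet> x = (d - 2) * (u \<bullet> (g x *v v))"
proof -
  note swap = contract3_swap[OF sym3_cubic[OF assms]]
  have "contract3 (cubic x) u v \<bullet> x = contract3 (cubic x) x u \<bullet> v"
    using swap by metis
  also have "\<dots> = (\<Sum>c\<in>UNIV. \<Sum>b\<in>UNIV. \<Sum>a\<in>UNIV. cubic x a b c * x $ a * u $ b * v $ c)"
    unfolding contract3_inner by (intro sum.cong refl sum.swap)
  also have "\<dots> = (\<Sum>c\<in>UNIV. \<Sum>b\<in>UNIV. \<kappa> * (\<Sum>a\<in>UNIV. f3 f a b c x * x $ a) * u $ b * v $ c)"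
    by (simp add: cubic_eq[OF assms] sum_distrib_left sum_distrib_right mult_ac)
  also have "\<dots> = (\<Sum>b\<in>UNIV. \<Sum>c\<in>UNIV. \<kappa> * (\<Sum>a\<in>UNIV. f3 f a b c x * x $ a) * u $ b * v $ c)"
    by (rule sum.swap)
  also have "\<dots> = (d - 2) * (u \<bullet> (g x *v v))"
    unfolding euler3[OF assms] form_inner metric_entry by (simp add: sum_distrib_left mult_ac)
  finally show ?thesis .
qed

lemma transpose_metric: "x \<in> U \<Longrightarrow> transpose (g x) = g x"
  by (simp add: transpose_def vec_eq_iff sym_G)

lemma frame_spans:
  assumes "x \<in> U" "f x = 1" "span {v, w} = {u. gradient f x \<bullet> u = 0}"
  shows "\<exists>r s t. u = r *\<^sub>R x + s *\<^sub>R v + t *\<^sub>R w"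
proof -
  \<comment> \<open>The gradient pairs with \<open>x\<close> to \<open>d\<close> on the surface, so
    this multiple of \<open>x\<close> leaves a tangential remainder.\<close>
  define r where "r = gradient f x \<bullet> u / d"
  have "gradient f x \<bullet> (u - r *\<^sub>R x) = 0"
    using gradient_inner_position[OF assms(1)] assms(2) degree by (simp add: inner_diff_right r_def)
  then have "u - r *\<^sub>R x \<in> span {v, w}"
    using assms(3) by blast
  then obtain s t where "u - r *\<^sub>R x - s *\<^sub>R v - t *\<^sub>R w = 0"
    unfolding span_breakdown_eq by (auto simp: span_empty)
  then have "u = r *\<^sub>R x + s *\<^sub>R v + t *\<^sub>R w"
    by (simp add: algebra_simps)
  then show ?thesis by blast
qed

lemma span_tangent:
  assumes "span {v, w} = {u. gradient f x \<bullet> u = 0}"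
  shows "gradient f x \<bullet> v = 0" "gradient f x \<bullet> w = 0"
  using assms span_base[of v "{v, w}"] span_base[of w "{v, w}"] by auto

lemma tangent_plane_orthogonal:
  assumes "x \<in> U" "span {v, w} = {u. gradient f x \<bullet> u = 0}"
  shows "x \<bullet> (g x *v v) = 0" "x \<bullet> (g x *v w) = 0"
  using span_tangent[OF assms(2)] by (simp_all add: position_metric[OF assms(1)])

lemma curvature_tangent_plane:
  assumes x: "x \<in> U" "f x = 1" and plane: "span {v, w} = {u. gradient f x \<bullet> u = 0}"
  shows "sectional_curvature g x v w = d\<^sup>2 * (d - 1)\<^sup>2 / (4 * (d - 2)\<^sup>2) * clebsch_S f x / (hessdet f x)\<^sup>2"
proof -
  define D where "D = (v \<bullet> (g x *v v)) * (w \<bullet> (g x *v w)) - (v \<bullet> (g x *v w))\<^sup>2"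
  define J where "J = contract3 (cubic x) v v \<bullet> (matrix_inv (g x) *v contract3 (cubic x) w w)
              - contract3 (cubic x) v w \<bullet> (matrix_inv (g x) *v contract3 (cubic x) v w)"
  note frame = transpose_metric[OF x(1)] det_G[OF x(1)] tangent_plane_orthogonal[OF x(1) plane] frame_spans[OF x plane]
  have D: "D \<noteq> 0"
    unfolding D_def by (rule inverse_form_orthogonal_frame(2)[OF frame])
  have "(d - 2)\<^sup>2 * (det (g x))\<^sup>2 * J = clebsch_form (cubic x) * (x \<bullet> (g x *v x)) * D"
    unfolding J_def D_def
    by (rule clebsch_form_eq_curvature_form[OF sym3_cubic[OF x(1)] frame cubic_position[OF x(1)]])
  \<comment> \<open>The minus sign is the norm of the position vector, \<open>- f x = -1\<close>; it
    compensates the one in \<open>riem4_cubic\<close>.\<close>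
  then have "(d - 2)\<^sup>2 * (\<kappa> ^ 3 * hessdet f x)\<^sup>2 * J = - (\<kappa> ^ 4 * clebsch_S f x) * D"
    unfolding position_norm[OF x(1)] x(2) det_metric cubic_eq[OF x(1)] clebsch_form_cmult clebsch_S_eq_form
    by simp
  \<comment> \<open>The squared determinant supplies \<open>\<kappa> ^ 6\<close>, of which four
    powers cancel against the quartic invariant. The remaining \<open>\<kappa>^2\<close> produces
    \<open>d^2 * (d - 1)^2\<close>.\<close>
  then have "\<kappa> ^ 4 * ((d - 2)\<^sup>2 * \<kappa>\<^sup>2 * (hessdet f x)\<^sup>2 * J) = \<kappa> ^ 4 * (- clebsch_S f x * D)"
    by (simp add: power_mult_distrib algebra_simps flip: power_add power_mult)
  then have J: "(d - 2)\<^sup>2 * \<kappa>\<^sup>2 * (hessdet f x)\<^sup>2 * J = - clebsch_S f x * D"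
    using \<kappa>_nonzero unfolding mult_cancel_left by simp
  have k: "\<kappa>\<^sup>2 * (d\<^sup>2 * (d - 1)\<^sup>2) = 1"
    using degree by (simp add: \<kappa>_def power_divide power_mult_distrib)
  have "sectional_curvature g x v w = - (1/4) * J / D"
    unfolding sectional_curvature_def riem4_cubic[OF x(1)] metric_ip_eq_inner J_def D_def ..
  also have "\<dots> = d\<^sup>2 * (d - 1)\<^sup>2 / (4 * (d - 2)\<^sup>2) * clebsch_S f x / (hessdet f x)\<^sup>2"
  proof -
    have nz: "(d - 2)\<^sup>2 * (hessdet f x)\<^sup>2 \<noteq> 0"
      using degree nondegenerate[OF x(1)] by simp
    have "- J * ((d - 2)\<^sup>2 * (hessdet f x)\<^sup>2) = (\<kappa>\<^sup>2 * (d\<^sup>2 * (d - 1)\<^sup>2)) * (- J * ((d - 2)\<^sup>2 * (hessdet f x)\<^sup>2))"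
      unfolding k by simp
    also have "\<dots> = - (d\<^sup>2 * (d - 1)\<^sup>2) * ((d - 2)\<^sup>2 * \<kappa>\<^sup>2 * (hessdet f x)\<^sup>2 * J)"
      by (simp add: mult_ac)
    also have "\<dots> = d\<^sup>2 * (d - 1)\<^sup>2 * clebsch_S f x * D"
      unfolding J by simp
    finally have "- J / D = d\<^sup>2 * (d - 1)\<^sup>2 * clebsch_S f x / ((d - 2)\<^sup>2 * (hessdet f x)\<^sup>2)"
      unfolding frac_eq_eq[OF D nz] .
    then show ?thesis by simp
  qed
  finally show ?thesis .
qed

end

section \<open>The level surface and its Gauss equation\<close>

locale level_surface_param = homogeneous_function f U d for f U d +
  fixes \<phi> :: "real^2 \<Rightarrow> real^3" and V :: "(real^2) set"
  assumes param: "local_param \<phi> V {x \<in> U. f x = 1}"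
begin

sublocale hessian_type_pullback g U \<phi> V
  by unfold_locales (use param in \<open>auto simp: local_param_def\<close>)

lemma on_surface: "y \<in> V \<Longrightarrow> f (\<phi> y) = 1"
  using param by (auto simp: local_param_def)

lemma jac_col_tangent: "jac_col \<phi> a = tangent a"
  by (rule ext) (simp add: jac_col_def tangent_def tangent_pd_def)

lemma pullback_induced: "pullback_metric g \<phi> = induced"
  by (rule ext) (simp add: pullback_metric_def induced_def jac_col_tangent metric_ip_eq_inner)

lemma gradient_tangent:
  assumes "y \<in> V"
  shows "gradient f (\<phi> y) \<bullet> tangent a y = 0"
proof -
  have "gradient f (\<phi> y) \<bullet> tangent a y = pd a (\<lambda>z. f (\<phi> z)) y"
    using pd_compose[of f \<phi> y a, OF smooth_on_differentiable[OF smooth open_dom mem_U[OF assms]]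
      smooth_on_differentiable[OF smooth_\<phi> open_V assms]]
    by (simp add: gradient_def inner_vec_def tangent_def tangent_pd_def)
  also have "\<dots> = pd a (\<lambda>z. 1) y"
    by (rule pd_cong[OF open_V assms]) (rule on_surface)
  finally show ?thesis by simp
qed

lemma tangent_plane:
  assumes "y \<in> V"
  shows "span {tangent 1 y, tangent 2 y} = {u. gradient f (\<phi> y) \<bullet> u = 0}"
proof (rule span_eq_hyperplane)
  show "independent {tangent 1 y, tangent 2 y}" "tangent 1 y \<noteq> tangent 2 y"
    using param assms unfolding local_param_def jac_col_tangent by blast+
  show "gradient f (\<phi> y) \<noteq> 0"
    using gradient_inner_position[OF mem_U[OF assms]] on_surface[OF assms] degree by auto
qed (rule gradient_tangent[OF assms])+

lemma surface_frame:
  assumes "y \<in> V"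
  shows "transpose (g (\<phi> y)) = g (\<phi> y)" "det (g (\<phi> y)) \<noteq> 0"
    "\<phi> y \<bullet> (g (\<phi> y) *v tangent 1 y) = 0" "\<phi> y \<bullet> (g (\<phi> y) *v tangent 2 y) = 0"
    "\<exists>r s t. u = r *\<^sub>R \<phi> y + s *\<^sub>R tangent 1 y + t *\<^sub>R tangent 2 y"
  using transpose_metric[OF mem_U[OF assms]] det_G[OF mem_U[OF assms]]
    tangent_plane_orthogonal[OF mem_U[OF assms] tangent_plane[OF assms]]
    frame_spans[OF mem_U[OF assms] on_surface[OF assms] tangent_plane[OF assms]] by blast+

lemma induced_entry: "induced y $ a $ b = tangent a y \<bullet> (g (\<phi> y) *v tangent b y)"
  by (simp add: induced_def)

sublocale induced: smooth_metric induced V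
proof
  show "open V" by (rule open_V)
  show "smooth_on (\<lambda>y. induced y $ i $ j) V" for i j by (rule smooth_induced)
  show "induced y $ i $ j = induced y $ j $ i" if "y \<in> V" for y i j
    unfolding induced_entry by (rule pulled_metric_form_swap[OF that])
  \<comment> \<open>This determinant is the tangential factor \<open>D\<close> of the Gram
    determinant.\<close>
  show "det (induced y) \<noteq> 0" if "y \<in> V" for y
    using inverse_form_orthogonal_frame(2)[OF surface_frame[OF that]]
      pulled_metric_form_swap[OF that, of "tangent 2 y" "tangent 1 y"]
    by (simp add: det_2 induced_entry power2_eq_square)
qed

text \<open>Differentiate the orthogonality of \<open>\<phi>\<close> and \<open>tangent a\<close>:
  the metric contributes \<open>d - 2\<close> and the derivative of \<open>\<phi>\<close>
  contributes 1, which the second derivative has to balance.\<close>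

lemma position_second:
  assumes "y \<in> V"
  shows "\<phi> y \<bullet> (g (\<phi> y) *v second b a y) = - (d - 1) * (tangent b y \<bullet> (g (\<phi> y) *v tangent a y))"
proof -
  have "0 = pd b (\<lambda>z. \<phi> z \<bullet> (g (\<phi> z) *v tangent a z)) y"
  proof -
    have "pd b (\<lambda>z. \<phi> z \<bullet> (g (\<phi> z) *v tangent a z)) y = pd b (\<lambda>z. 0) y"
      by (rule pd_cong[OF open_V assms]) (simp add: position_metric[OF mem_U] gradient_tangent)
    then show ?thesis by simp
  qed
  also have "\<dots> = contract3 (cubic (\<phi> y)) (tangent b y) (\<phi> y) \<bullet> tangent a y
      + tangent b y \<bullet> (g (\<phi> y) *v tangent a y) + \<phi> y \<bullet> (g (\<phi> y) *v second b a y)"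
    using differentiable_pulled[OF assms] smooth_on_differentiable[OF smooth_\<phi> open_V assms]
    by (simp add: pd_form_inner pd_pulled_metric[OF assms] second_def tangent_def[of b])
  also have "contract3 (cubic (\<phi> y)) (tangent b y) (\<phi> y) \<bullet> tangent a y = (d - 2) * (tangent b y \<bullet> (g (\<phi> y) *v tangent a y))"
    unfolding contract3_cubic_swap(2)[OF assms, of _ "\<phi> y"] by (rule cubic_position[OF mem_U[OF assms]])
  finally show ?thesis by (simp add: algebra_simps)
qed

text \<open>The ambient covariant derivative of \<open>tangent k\<close> in direction
  \<open>tangent j\<close>, lowered to a covector. Its tangential part carries the symbols of the
  surface, its pairing with the position vector the second fundamental form.\<close>

definition acceleration :: "2 \<Rightarrow> 2 \<Rightarrow> real^2 \<Rightarrow> real^3" where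
  "acceleration j k y = (1/2) *\<^sub>R contract3 (cubic (\<phi> y)) (tangent j y) (tangent k y) + g (\<phi> y) *v second j k y"

lemma christoffel1_acceleration:
  assumes "y \<in> V"
  shows "christoffel1 induced m j k y = acceleration j k y \<bullet> tangent m y"
  unfolding christoffel1_induced[OF assms] acceleration_def
  using pulled_metric_form_swap[OF assms, of "second j k y" "tangent m y"]
  by (simp add: inner_left_distrib inner_commute[of "g (\<phi> y) *v second j k y"])

lemma acceleration_commute: "y \<in> V \<Longrightarrow> acceleration j k y = acceleration k j y"
  unfolding acceleration_def using second_commute contract3_cubic_swap(1) by metis

lemma acceleration_position:
  assumes "y \<in> V"
  shows "acceleration j k y \<bullet> \<phi> y = - (d / 2) * induced y $ j $ k"
proof -
  have "(g (\<phi> y) *v second j k y) \<bullet> \<phi> y = - (d - 1) * induced y $ j $ k"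
    using position_second[OF assms, of j k] by (simp add: inner_commute induced_entry)
  then show ?thesis
    by (simp add: acceleration_def inner_left_distrib cubic_position[OF mem_U[OF assms]] flip: induced_entry)
      (simp add: field_simps)
qed

text \<open>The tangential part of the ambient inverse form is the contraction of the surface's
  symbols. The normal part is \<open>(d / 2)^2\<close> times metric entries, divided by the norm
  \<open>-1\<close> of the position vector; moved across it gets a plus sign.\<close>

lemma christoffel_induced_form:
  assumes "y \<in> V"
  shows "(\<Sum>l\<in>UNIV. christoffel1 induced l i m y * christoffel induced l j k y) =
     acceleration i m y \<bullet> (matrix_inv (g (\<phi> y)) *v acceleration j k y)
     + d\<^sup>2 / 4 * (induced y $ i $ m * induced y $ j $ k)"
proof -
  have sym: "induced y $ 2 $ 1 = induced y $ 1 $ 2" by (rule induced.sym_G[OF assms])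
  have "acceleration i m y \<bullet> (matrix_inv (g (\<phi> y)) *v acceleration j k y) =
     (acceleration i m y \<bullet> \<phi> y) * (acceleration j k y \<bullet> \<phi> y) / (\<phi> y \<bullet> (g (\<phi> y) *v \<phi> y))
      + (\<Sum>l\<in>UNIV. christoffel1 induced l i m y * christoffel induced l j k y)"
    unfolding christoffel_eq inverse_form_2[OF induced.det_G[OF assms] sym] christoffel1_acceleration[OF assms]
      inverse_form_orthogonal_frame(3)[OF surface_frame[OF assms]] induced_entry ..
  then show ?thesis
    unfolding acceleration_position[OF assms] position_norm[OF mem_U[OF assms]] on_surface[OF assms]
    by (simp add: power2_eq_square algebra_simps)
qed

lemma riem4_induced:
  assumes "y \<in> V"
  shows "riem4 induced y (axis 1 1) (axis 2 1) (axis 2 1) (axis 1 1) =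
     riem4 g (\<phi> y) (tangent 1 y) (tangent 2 y) (tangent 2 y) (tangent 1 y)
     - d\<^sup>2 / 4 * (induced y $ 1 $ 1 * induced y $ 2 $ 2 - (induced y $ 1 $ 2)\<^sup>2)"
proof -
  have sym: "induced y $ 2 $ 1 = induced y $ 1 $ 2" by (rule induced.sym_G[OF assms])
  have "riem4 induced y (axis 1 1) (axis 2 1) (axis 2 1) (axis 1 1) = (\<Sum>l\<in>UNIV. induced y $ 1 $ l * riemann induced l 1 2 2 y)"
    by (simp add: riem4_def sum_2 axis_def sym mult.commute)
  also have "\<dots> = pd 1 (christoffel1 induced 1 2 2) y - pd 2 (christoffel1 induced 1 1 2) y
     - ((\<Sum>l\<in>UNIV. christoffel1 induced l 1 1 y * christoffel induced l 2 2 y)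
       - (\<Sum>l\<in>UNIV. christoffel1 induced l 2 1 y * christoffel induced l 1 2 y))"
    unfolding induced.lower_riemann[OF assms] by (simp add: sum_subtractf)
  finally show ?thesis
    \<comment> \<open>After \<open>half_sum_inverse_form\<close> all terms with second derivatives
      of \<open>\<phi>\<close> cancel against the alternation. The purely cubic terms form the
      ambient curvature and the \<open>d^2 / 4\<close> terms the Gram determinant.\<close>
    unfolding christoffel1_induced_alternation[OF assms] christoffel_induced_form[OF assms] sym
      riem4_cubic[OF mem_U[OF assms]] acceleration_commute[OF assms, of 2 1] second_commute[OF assms, of 2 1]
      contract3_cubic_swap(1)[OF assms, of "tangent 2 y" "tangent 1 y"]
    unfolding acceleration_def half_sum_inverse_form[OF transpose_metric[OF mem_U[OF assms]] det_G[OF mem_U[OF assms]]]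
    using pulled_metric_form_swap[OF assms, of "second 2 2 y" "second 1 1 y"]
    by (simp add: power2_eq_square algebra_simps)
qed

text \<open>The two curvatures share their denominator, because \<open>induced\<close> on coordinate
  vectors is the ambient metric on tangent vectors; dividing the Gauss equation by it isolates the
  constant.\<close>

lemma curvature_surface:
  assumes "y \<in> V"
  shows "sectional_curvature (pullback_metric g \<phi>) y (axis 1 1) (axis 2 1) =
    - (d\<^sup>2 / 4) + sectional_curvature g (\<phi> y) (tangent 1 y) (tangent 2 y)"
proof -
  have ip: "metric_ip induced y (axis a 1) (axis b 1) = induced y $ a $ b" for a b
    by (simp add: metric_ip_def axis_def if_distrib[of "\<lambda>r. _ * r"] cong: if_cong)
  have nz: "induced y $ 1 $ 1 * induced y $ 2 $ 2 - (induced y $ 1 $ 2)\<^sup>2 \<noteq> 0"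
    using induced.det_G[OF assms] induced.sym_G[OF assms, of 2 1] by (simp add: det_2 power2_eq_square)
  have split: "(r - c * h) / h = - c + r / h" if "h \<noteq> 0" for r c h :: real
    using that by (simp add: diff_divide_distrib)
  show ?thesis
    unfolding pullback_induced sectional_curvature_def riem4_induced[OF assms] ip split[OF nz]
    unfolding metric_ip_eq_inner induced_entry[symmetric] ..
qed

end

theorem theorem3p1:
  fixes f :: "real^3 \<Rightarrow> real" and U :: "(real^3) set" and d :: real and p :: "real^3"
  assumes "open U"
    and "smooth_on f U"
    and "d > 2"
    and "\<forall>x\<in>U. \<forall>t>0. t *\<^sub>R x \<in> U \<longrightarrow> f (t *\<^sub>R x) = t powr d * f x"
    and "\<forall>x\<in>U. hessdet f x \<noteq> 0"
    and "p \<in> U" and "f p = 1"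
  shows "(\<forall>v w. span {v, w} = {u. gradient f p \<bullet> u = 0} \<longrightarrow>
            sectional_curvature (hess_metric d f) p v w
              = d^2 * (d - 1)^2 / (4 * (d - 2)^2) * clebsch_S f p * f p / (hessdet f p)^2)
       \<and> (\<forall>\<phi> V q. local_param \<phi> V {x \<in> U. f x = 1} \<and> q \<in> V \<and> \<phi> q = p \<longrightarrow>
            sectional_curvature (pullback_metric (hess_metric d f) \<phi>) q (axis 1 1) (axis 2 1)
              = - (d^2 / 4) + d^2 * (d - 1)^2 / (4 * (d - 2)^2) * clebsch_S f p * (f p)^2 / (hessdet f p)^2)"
proof -
  interpret homogeneous_function f U d
    using assms by unfold_locales auto
  have "sectional_curvature (hess_metric d f) p v w
      = d^2 * (d - 1)^2 / (4 * (d - 2)^2) * clebsch_S f p * f p / (hessdet f p)^2"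
    if "span {v, w} = {u. gradient f p \<bullet> u = 0}" for v w
    \<comment> \<open>The general formula carries no power of \<open>f\<close>; here and below it is
      inserted through \<open>f p = 1\<close>.\<close>
    unfolding curvature_tangent_plane[OF assms(6,7) that] assms(7) by simp
  moreover have "sectional_curvature (pullback_metric (hess_metric d f) \<phi>) q (axis 1 1) (axis 2 1)
     = - (d^2 / 4) + d^2 * (d - 1)^2 / (4 * (d - 2)^2) * clebsch_S f p * (f p)^2 / (hessdet f p)^2"
    if \<phi>: "local_param \<phi> V {x \<in> U. f x = 1}" and q: "q \<in> V" "\<phi> q = p" for \<phi> V q
  proof -
    interpret level_surface_param f U d \<phi> V
      using \<phi> by unfold_locales
    show ?thesis
      unfolding curvature_surface[OF q(1)]
      using curvature_tangent_plane[OF mem_U on_surface tangent_plane, OF q(1) q(1) q(1)] q(2) assms(7) by simp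
  qed
  ultimately show ?thesis by blast
qed

end
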